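(* (In $\mathbf{ZF}$.) Suppose that $\mathbf{X}$ is a Loeb regular space. If $\mathbf{X}$ is first-countable, then the following conditions are equivalent: (i) $\mathbf{X}$ is sequential; (ii) for every family $\{A_j:j\in J\}$ of non-empty sequentially closed subsets of $\mathbf{X}$, there exists a family $\{B_j:j\in J\}$ of non-empty well-orderable sets such that $B_j\subseteq A_j$ for each $j\in J$; (iii) for every family $\{A_n:n\in\omega\}$ of non-empty sequentially closed subsets of $\mathbf{X}$, there exist an infinite subset $N$ of $\omega$ and a family $\{B_n:n\in N\}$ of non-empty well-orderable sets such that $B_n\subseteq A_n$ for each $n\in N$. Moreover, if $\mathbf{X}$ is second-countable, then conditions (i)–(iii) are equivalent to the following: (iv) for every family $\{A_n:n\in\omega\}$ of non-empty sequentially closed subsets of $\mathbf{X}$, there exists a family $\{D_n:n\in\omega\}$ of countable sets such that $D_n\subseteq A_n\subseteq\mathrm{cl}_{\mathbf{X}}(D_n)$ for each $n\in\omega$ and, moreover, the set $D=\bigcup_{n\in\omega}D_n$ is countable.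
   Context: The base theory is $\mathbf{ZF}$. A subset $A$ of a topological space $\mathbf{X}$ is sequentially closed in $\mathbf{X}$ if all limits of convergent in $\mathbf{X}$ sequences of points of $A$ belong to $A$; $\mathbf{X}$ is sequential if all its sequentially closed subsets are closed. A topological space is Loeb if it is empty or the collection of all its non-empty closed subsets has a choice function. Regular means that points and closed sets not containing them can be separated by disjoint open sets (no further separation axiom is included in the definition). Here $\mathrm{cl}_{\mathbf{X}}$ denotes closure in $\mathbf{X}$; countable means finite or countably infinite. *)

theory Defs
  imports Main
begin

text \<open>
  HOL proves the axiom of choice for its own sets and functions, so a theorem of ZF cannot be
  stated about HOL sets without becoming trivial.  It is stated instead about an arbitrary
  first-order model of ZF: a type \<open>'v\<close> (the universe) with a membership relation satisfying the
  ZF axioms, with separation and replacement restricted to first-order formulas (with parameters).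
  By soundness and completeness of first-order logic, truth in all such models is the same as
  provability in ZF.

  Every notion below is evaluated inside the model: spaces, topologies, sequences, families,
  choice functions, bijections and well-orders are elements of \<open>'v\<close>, and all quantifiers
  range over \<open>'v\<close>.
\<close>

text \<open>Formulas of the language of set theory; variables are de Bruijn indices.\<close>

datatype fm =
    Mem nat nat
  | Equal nat nat
  | Neg fm
  | Conj fm fm
  | All fm

locale membership =
  fixes mem :: "'v \<Rightarrow> 'v \<Rightarrow> bool"
begin

primrec sat :: "(nat \<Rightarrow> 'v) \<Rightarrow> fm \<Rightarrow> bool" where
  "sat e (Mem i j) \<longleftrightarrow> mem (e i) (e j)"
| "sat e (Equal i j) \<longleftrightarrow> e i = e j"
| "sat e (Neg p) \<longleftrightarrow> \<not> sat e p"
| "sat e (Conj p q) \<longleftrightarrow> sat e p \<and> sat e q"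
| "sat e (All p) \<longleftrightarrow> (\<forall>a. sat (case_nat a e) p)"

text \<open>
  The HOL set \<open>elts a\<close> is only a notation for the first-order class of members of \<open>a\<close>; no
  quantification over HOL sets occurs below.
\<close>

definition elts :: "'v \<Rightarrow> 'v set" where
  "elts a = {x. mem x a}"

definition is_inductive :: "'v \<Rightarrow> bool" where
  "is_inductive w \<longleftrightarrow> (\<exists>z\<in>elts w. elts z = {})
     \<and> (\<forall>x\<in>elts w. \<exists>y\<in>elts w. elts y = insert x (elts x))"

definition omega :: "'v" where
  "omega = (THE w. is_inductive w \<and> (\<forall>v. is_inductive v \<longrightarrow> elts w \<subseteq> elts v))"

definition upair :: "'v \<Rightarrow> 'v \<Rightarrow> 'v" where
  "upair a b = (THE z. elts z = {a, b})"

definition opair :: "'v \<Rightarrow> 'v \<Rightarrow> 'v" where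
  "opair a b = upair (upair a a) (upair a b)"

text \<open>
  \<open>fun_on f A\<close>: \<open>f\<close> is (the graph of) a function with domain \<open>A\<close>.  A family indexed by \<open>J\<close> is
  a function on \<open>J\<close>.
\<close>

definition fun_on :: "'v \<Rightarrow> 'v \<Rightarrow> bool" where
  "fun_on f A \<longleftrightarrow> (\<forall>p\<in>elts f. \<exists>x\<in>elts A. \<exists>y. p = opair x y)
     \<and> (\<forall>x\<in>elts A. \<exists>!y. opair x y \<in> elts f)"

definition app :: "'v \<Rightarrow> 'v \<Rightarrow> 'v" where
  "app f x = (THE y. opair x y \<in> elts f)"

definition equipotent :: "'v \<Rightarrow> 'v \<Rightarrow> bool" where
  "equipotent A B \<longleftrightarrow> (\<exists>f. fun_on f A \<and> bij_betw (app f) (elts A) (elts B))"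

definition fin :: "'v \<Rightarrow> bool" where
  "fin A \<longleftrightarrow> (\<exists>n\<in>elts omega. equipotent A n)"

definition ctbl :: "'v \<Rightarrow> bool" where
  "ctbl A \<longleftrightarrow> fin A \<or> equipotent A omega"

definition well_orders :: "'v \<Rightarrow> 'v \<Rightarrow> bool" where
  "well_orders r A \<longleftrightarrow>
     (\<forall>x\<in>elts A. opair x x \<in> elts r)
   \<and> (\<forall>x\<in>elts A. \<forall>y\<in>elts A. opair x y \<in> elts r \<and> opair y x \<in> elts r \<longrightarrow> x = y)
   \<and> (\<forall>x\<in>elts A. \<forall>y\<in>elts A. \<forall>z\<in>elts A.
        opair x y \<in> elts r \<and> opair y z \<in> elts r \<longrightarrow> opair x z \<in> elts r)
   \<and> (\<forall>x\<in>elts A. \<forall>y\<in>elts A. opair x y \<in> elts r \<or> opair y x \<in> elts r)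
   \<and> (\<forall>S. elts S \<subseteq> elts A \<and> elts S \<noteq> {} \<longrightarrow> (\<exists>m\<in>elts S. \<forall>x\<in>elts S. opair m x \<in> elts r))"

definition well_orderable :: "'v \<Rightarrow> bool" where
  "well_orderable A \<longleftrightarrow> (\<exists>r. well_orders r A)"


text \<open>A topological space is a set \<open>X\<close> with its set \<open>T\<close> of open sets.\<close>

definition top_space :: "'v \<Rightarrow> 'v \<Rightarrow> bool" where
  "top_space X T \<longleftrightarrow>
     (\<forall>U\<in>elts T. elts U \<subseteq> elts X)
   \<and> (\<exists>U\<in>elts T. elts U = {})
   \<and> X \<in> elts T
   \<and> (\<forall>U\<in>elts T. \<forall>V\<in>elts T. \<exists>W\<in>elts T. elts W = elts U \<inter> elts V)
   \<and> (\<forall>S. elts S \<subseteq> elts T \<longrightarrow> (\<exists>W\<in>elts T. elts W = (\<Union>U\<in>elts S. elts U)))"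

definition closed_in :: "'v \<Rightarrow> 'v \<Rightarrow> 'v \<Rightarrow> bool" where
  "closed_in X T C \<longleftrightarrow> elts C \<subseteq> elts X \<and> (\<exists>U\<in>elts T. elts U = elts X - elts C)"

definition closure_class :: "'v \<Rightarrow> 'v \<Rightarrow> 'v \<Rightarrow> 'v set" where
  "closure_class X T D =
     {x \<in> elts X. \<forall>C. closed_in X T C \<and> elts D \<subseteq> elts C \<longrightarrow> x \<in> elts C}"

definition regular :: "'v \<Rightarrow> 'v \<Rightarrow> bool" where
  "regular X T \<longleftrightarrow> (\<forall>C x. closed_in X T C \<and> x \<in> elts X - elts C \<longrightarrow>
     (\<exists>U\<in>elts T. \<exists>V\<in>elts T. x \<in> elts U \<and> elts C \<subseteq> elts V \<and> elts U \<inter> elts V = {}))"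

definition loeb :: "'v \<Rightarrow> 'v \<Rightarrow> bool" where
  "loeb X T \<longleftrightarrow> elts X = {} \<or>
     (\<exists>K f. elts K = {C. closed_in X T C \<and> elts C \<noteq> {}}
        \<and> fun_on f K \<and> (\<forall>C\<in>elts K. app f C \<in> elts C))"

definition first_countable :: "'v \<Rightarrow> 'v \<Rightarrow> bool" where
  "first_countable X T \<longleftrightarrow> (\<forall>x\<in>elts X. \<exists>B. ctbl B \<and> elts B \<subseteq> elts T
     \<and> (\<forall>V\<in>elts B. x \<in> elts V)
     \<and> (\<forall>U\<in>elts T. x \<in> elts U \<longrightarrow> (\<exists>V\<in>elts B. elts V \<subseteq> elts U)))"

definition second_countable :: "'v \<Rightarrow> 'v \<Rightarrow> bool" where
  "second_countable X T \<longleftrightarrow> (\<exists>B. ctbl B \<and> elts B \<subseteq> elts T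
     \<and> (\<forall>U\<in>elts T. \<forall>x\<in>elts U. \<exists>V\<in>elts B. x \<in> elts V \<and> elts V \<subseteq> elts U))"

definition seq_in :: "'v \<Rightarrow> 'v \<Rightarrow> bool" where
  "seq_in A s \<longleftrightarrow> fun_on s omega \<and> (\<forall>n\<in>elts omega. app s n \<in> elts A)"

text \<open>On \<open>omega\<close>, \<open>m \<le> n\<close> is \<open>m = n\<close> or \<open>m\<close> is a member of \<open>n\<close>.\<close>

definition converges :: "'v \<Rightarrow> 'v \<Rightarrow> 'v \<Rightarrow> 'v \<Rightarrow> bool" where
  "converges X T s x \<longleftrightarrow> x \<in> elts X \<and> (\<forall>U\<in>elts T. x \<in> elts U \<longrightarrow>
     (\<exists>m\<in>elts omega. \<forall>n\<in>elts omega. m = n \<or> m \<in> elts n \<longrightarrow> app s n \<in> elts U))"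

definition seq_closed :: "'v \<Rightarrow> 'v \<Rightarrow> 'v \<Rightarrow> bool" where
  "seq_closed X T A \<longleftrightarrow> elts A \<subseteq> elts X
     \<and> (\<forall>s x. seq_in A s \<and> converges X T s x \<longrightarrow> x \<in> elts A)"

definition sequential :: "'v \<Rightarrow> 'v \<Rightarrow> bool" where
  "sequential X T \<longleftrightarrow> (\<forall>A. seq_closed X T A \<longrightarrow> closed_in X T A)"

definition seq_closed_family :: "'v \<Rightarrow> 'v \<Rightarrow> 'v \<Rightarrow> 'v \<Rightarrow> bool" where
  "seq_closed_family X T J A \<longleftrightarrow> fun_on A J
     \<and> (\<forall>j\<in>elts J. elts (app A j) \<noteq> {} \<and> seq_closed X T (app A j))"

definition wo_selection :: "'v \<Rightarrow> 'v \<Rightarrow> bool" where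
  "wo_selection X T \<longleftrightarrow> (\<forall>J A. seq_closed_family X T J A \<longrightarrow>
     (\<exists>B. fun_on B J \<and> (\<forall>j\<in>elts J. elts (app B j) \<noteq> {} \<and> well_orderable (app B j)
        \<and> elts (app B j) \<subseteq> elts (app A j))))"

definition partial_wo_selection :: "'v \<Rightarrow> 'v \<Rightarrow> bool" where
  "partial_wo_selection X T \<longleftrightarrow> (\<forall>A. seq_closed_family X T omega A \<longrightarrow>
     (\<exists>N B. elts N \<subseteq> elts omega \<and> \<not> fin N \<and> fun_on B N
        \<and> (\<forall>n\<in>elts N. elts (app B n) \<noteq> {} \<and> well_orderable (app B n)
             \<and> elts (app B n) \<subseteq> elts (app A n))))"

definition countable_dense_selection :: "'v \<Rightarrow> 'v \<Rightarrow> bool" where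
  "countable_dense_selection X T \<longleftrightarrow> (\<forall>A. seq_closed_family X T omega A \<longrightarrow>
     (\<exists>D. fun_on D omega
        \<and> (\<forall>n\<in>elts omega. ctbl (app D n) \<and> elts (app D n) \<subseteq> elts (app A n)
             \<and> elts (app A n) \<subseteq> closure_class X T (app D n))
        \<and> (\<exists>U. elts U = (\<Union>n\<in>elts omega. elts (app D n)) \<and> ctbl U)))"

end

locale zf_model = membership +
  assumes extensionality: "elts x = elts y \<Longrightarrow> x = y"
    and foundation: "elts x \<noteq> {} \<Longrightarrow> \<exists>y\<in>elts x. elts x \<inter> elts y = {}"
    and pairing: "\<exists>z. elts z = {x, y}"
    and union: "\<exists>u. elts u = (\<Union>y\<in>elts x. elts y)"
    and powerset: "\<exists>p. elts p = {z. elts z \<subseteq> elts x}"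
    and infinity: "\<exists>w. is_inductive w"
    and separation: "\<exists>y. elts y = {z \<in> elts x. sat (case_nat z e) p}"
    and replacement:
      "(\<And>x y y'. x \<in> elts a \<Longrightarrow> sat (case_nat x (case_nat y e)) p
          \<Longrightarrow> sat (case_nat x (case_nat y' e)) p \<Longrightarrow> y = y')
       \<Longrightarrow> \<exists>b. elts b = {y. \<exists>x\<in>elts a. sat (case_nat x (case_nat y e)) p}"
begin

text \<open>The definite descriptions above denote what they should.\<close>

lemma elts_upair: "elts (upair a b) = {a, b}"
proof -
  obtain z where z: "elts z = {a, b}" using pairing by blast
  show ?thesis
    unfolding upair_def by (rule theI[of "\<lambda>z. elts z = {a, b}", OF z]) (simp add: extensionality z)
qed

lemma opair_eq_iff: "opair a b = opair c d \<longleftrightarrow> a = c \<and> b = d"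
proof
  assume eq: "opair a b = opair c d"
  have u: "upair x y = upair z w \<longleftrightarrow> {x, y} = {z, w}" for x y z w
    by (metis elts_upair extensionality)
  from eq have "{upair a a, upair a b} = {upair c c, upair c d}"
    unfolding opair_def u .
  then show "a = c \<and> b = d"
    unfolding doubleton_eq_iff u by blast
qed simp

lemma app_eq:
  assumes "fun_on f A" "x \<in> elts A"
  shows "app f x = y \<longleftrightarrow> opair x y \<in> elts f"
proof -
  have ex1: "\<exists>!y. opair x y \<in> elts f"
    using assms by (simp add: fun_on_def)
  show ?thesis
    unfolding app_def using theI'[OF ex1] the1_equality[OF ex1] by blast
qed

lemma omega_least_inductive:
  "is_inductive omega \<and> (\<forall>v. is_inductive v \<longrightarrow> elts omega \<subseteq> elts v)"
proof -
  let ?P = "\<lambda>w. is_inductive w \<and> (\<forall>v. is_inductive v \<longrightarrow> elts w \<subseteq> elts v)"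
  define Or where "Or p q = Neg (Conj (Neg p) (Neg q))" for p q
  define Imp where "Imp p q = Neg (Conj p (Neg q))" for p q
  define Ex where "Ex p = Neg (All (Neg p))" for p
  have [simp]: "sat e (Or p q) \<longleftrightarrow> sat e p \<or> sat e q"
      "sat e (Imp p q) \<longleftrightarrow> (sat e p \<longrightarrow> sat e q)"
      "sat e (Ex p) \<longleftrightarrow> (\<exists>a. sat (case_nat a e) p)" for e p q
    by (auto simp: Or_def Imp_def Ex_def)
  define ind where "ind = Conj (Ex (Conj (Mem 0 1) (All (Neg (Mem 0 1)))))
    (All (Imp (Mem 0 1) (Ex (Conj (Mem 0 2)
       (All (Conj (Imp (Mem 0 1) (Or (Equal 0 2) (Mem 0 2)))
                  (Imp (Or (Equal 0 2) (Mem 0 2)) (Mem 0 1))))))))"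
  have ind: "sat (case_nat v e) ind \<longleftrightarrow> is_inductive v" for v e
  proof -
    have eq: "(\<forall>t. (mem t y \<longrightarrow> t = x \<or> mem t x) \<and> (t = x \<or> mem t x \<longrightarrow> mem t y)) \<longleftrightarrow>
        elts y = insert x (elts x)" for x y
      unfolding elts_def by blast
    have "(\<forall>t. \<not> mem t y) \<longleftrightarrow> elts y = {}" for y
      unfolding elts_def by blast
    with eq show ?thesis
      unfolding ind_def is_inductive_def
      by (simp add: numeral_2_eq_2 Bex_def Ball_def elts_def del: all_simps all_conj_distrib)
  qed
  obtain w where w: "is_inductive w" using infinity by blast
  obtain y where y: "elts y = {z \<in> elts w. sat (case_nat z (\<lambda>_. w)) (All (Imp ind (Mem 1 0)))}"
    using separation by blast
  then have y: "elts y = {z. \<forall>v. is_inductive v \<longrightarrow> z \<in> elts v}"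
    using w by (auto simp: ind elts_def)
  have zero: "\<exists>z\<in>elts v. elts z = {}" if "is_inductive v" for v
    using that by (simp add: is_inductive_def)
  have succ: "\<exists>s\<in>elts v. elts s = insert x (elts x)" if "is_inductive v" "x \<in> elts v" for v x
    using that by (simp add: is_inductive_def)
  have y_iff: "z \<in> elts y \<longleftrightarrow> (\<forall>v. is_inductive v \<longrightarrow> z \<in> elts v)" for z
    by (simp add: y)
  have "is_inductive y"
    unfolding is_inductive_def
  proof (intro conjI ballI)
    obtain z where z: "elts z = {}" using zero[OF w] by blast
    have "z \<in> elts v" if "is_inductive v" for v
    proof -
      obtain z' where z': "z' \<in> elts v" "elts z' = {}" using zero[OF \<open>is_inductive v\<close>] by blast
      then have "z' = z" using z extensionality by simp
      then show ?thesis using z' by simp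
    qed
    then show "\<exists>z\<in>elts y. elts z = {}" using z y_iff by blast
  next
    fix x assume x: "x \<in> elts y"
    have xv: "x \<in> elts v" if "is_inductive v" for v using x y_iff that by blast
    obtain s where s: "elts s = insert x (elts x)" using succ[OF w xv[OF w]] by blast
    have "s \<in> elts v" if v: "is_inductive v" for v
    proof -
      obtain s' where s': "s' \<in> elts v" "elts s' = insert x (elts x)"
        using succ[OF v xv[OF v]] by blast
      then have "s' = s" using s extensionality by simp
      then show ?thesis using s' by simp
    qed
    then show "\<exists>s\<in>elts y. elts s = insert x (elts x)" using s y_iff by blast
  qed
  then have Py: "?P y" using y_iff by blast
  show ?thesis
    unfolding omega_def
  proof (rule theI[of ?P, OF Py])
    show "v = y" if "?P v" for v
      by (rule extensionality) (use that Py in \<open>simp add: subset_antisym\<close>)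
  qed
qed

end

end

theory Submission
  imports Defs
begin

text \<open>
  Write (i) sequential, (ii) selection of well-orderable subsets, (iii) the same on an infinite set
  of indices, (iv) countable dense selection.  In a sequential space a sequentially closed set is
  closed, so the Loeb choice function \<open>f\<close> picks a point from every set of the family, and singletons
  are well-orderable: (i) implies (ii), and (iii) is a special case of (ii).

  The heart is (iii) \<open>\<Longrightarrow>\<close> (i).  Let \<open>A\<close> be sequentially closed, let \<open>x\<close> be in its closure, and let
  \<open>W\<^sub>n\<close> be a decreasing base at \<open>x\<close>.  The sets \<open>A \<inter> cl W\<^sub>n\<close> are sequentially closed and non-empty,
  so there are an infinite \<open>N\<close> and well-orderable non-empty \<open>B\<^sub>n \<subseteq> A \<inter> cl W\<^sub>n\<close> for \<open>n \<in> N\<close>.  The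
  well-orders come without a uniform choice, so they cannot be used to pick points of the \<open>B\<^sub>n\<close>
  simultaneously.  But \<open>c\<^sub>n = f (cl B\<^sub>n)\<close> is a uniform choice, and \<open>c\<^sub>n\<close> still lies in \<open>A\<close>: for a
  single \<open>n\<close> one well-order of \<open>B\<^sub>n\<close> and one base at \<open>c\<^sub>n\<close> give a sequence in \<open>B\<^sub>n\<close> that converges
  to \<open>c\<^sub>n\<close> (lemma \<open>well_orderable_cl_subset\<close>).  By regularity every neighbourhood of \<open>x\<close>
  contains some \<open>cl W\<^sub>n\<close>, so the \<open>c\<^sub>n\<close> converge to \<open>x\<close>, and \<open>x \<in> A\<close>.

  For a countable base \<open>\<B>\<close> and a sequential space, \<open>D\<^sub>n\<close> consists of the points
  \<open>f (cl (V \<inter> A\<^sub>n))\<close> with \<open>V \<in> \<B>\<close> meeting \<open>A\<^sub>n\<close>.  It is dense in \<open>A\<^sub>n\<close> by regularity, and the union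
  of the \<open>D\<^sub>n\<close> is an image of a part of \<open>\<omega> \<times> \<B>\<close>, hence countable.  Conversely (iv) implies (iii),
  since countable sets are well-orderable.

  The argument takes place in an arbitrary model of ZF.  Its \<open>omega\<close> need not be the standard one,
  so induction, finiteness and countability have to be developed inside the model, and every
  class that is turned into a set has to be definable by a first-order formula with parameters.
  The rules \<open>definable_intro\<close> prove definability along the shape of a predicate.
\<close>

section \<open>Definable predicates\<close>

text \<open>
  Renaming variables brings formulas with separate parameters to a common assignment.
\<close>

primrec rename :: "(nat \<Rightarrow> nat) \<Rightarrow> fm \<Rightarrow> fm" where
  "rename f (Mem i j) = Mem (f i) (f j)"
| "rename f (Equal i j) = Equal (f i) (f j)"
| "rename f (Neg p) = Neg (rename f p)"
| "rename f (Conj p q) = Conj (rename f p) (rename f q)"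
| "rename f (All p) = All (rename (case_nat 0 (\<lambda>i. Suc (f i))) p)"

named_theorems definable_intro

context membership
begin

lemma sat_rename: "sat e (rename f p) \<longleftrightarrow> sat (\<lambda>i. e (f i)) p"
proof (induction p arbitrary: e f)
  case (All p)
  have "(\<lambda>i. case_nat a e (case_nat 0 (\<lambda>i. Suc (f i)) i)) = case_nat a (\<lambda>i. e (f i))" for a
    by (auto split: nat.split)
  then show ?case by (simp add: All.IH)
qed simp_all

text \<open>
  A predicate of environments is definable if some formula expresses it when each of the variables
  of the formula is read (by \<open>g\<close>) either as an entry of the environment or as a fixed element of
  the model.  Allowing arbitrarily many parameters is harmless, because a formula mentions only
  finitely many variables.
\<close>

definition definable :: "((nat \<Rightarrow> 'v) \<Rightarrow> bool) \<Rightarrow> bool" where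
  "definable P \<longleftrightarrow> (\<exists>p g. \<forall>e. P e \<longleftrightarrow> sat (\<lambda>i. case_sum e id (g i)) p)"

definition definable_term :: "((nat \<Rightarrow> 'v) \<Rightarrow> 'v) \<Rightarrow> bool" where
  "definable_term t \<longleftrightarrow> definable (\<lambda>e. e 0 = t (\<lambda>i. e (Suc i)))"

lemma definableI: "(\<And>e. P e \<longleftrightarrow> sat (\<lambda>i. case_sum e id (g i)) p) \<Longrightarrow> definable P"
  unfolding definable_def by blast

lemma definable_cong: "definable P \<Longrightarrow> (\<And>e. Q e \<longleftrightarrow> P e) \<Longrightarrow> definable Q"
  unfolding definable_def by simp

lemma definable_not [definable_intro]: "definable P \<Longrightarrow> definable (\<lambda>e. \<not> P e)"
  unfolding definable_def by (metis sat.simps(3))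

lemma definable_conj [definable_intro]:
  assumes "definable P" "definable Q" shows "definable (\<lambda>e. P e \<and> Q e)"
proof -
  obtain p g where p: "\<And>e. P e \<longleftrightarrow> sat (\<lambda>i. case_sum e id (g i)) p"
    using assms(1) unfolding definable_def by blast
  obtain q h where q: "\<And>e. Q e \<longleftrightarrow> sat (\<lambda>i. case_sum e id (h i)) q"
    using assms(2) unfolding definable_def by blast
  show ?thesis
    \<comment> \<open>The two formulas keep their own variables and parameters: one gets the even,
      the other the odd positions.\<close>
    by (rule definableI[where g = "\<lambda>i. if even i then g (i div 2) else h (i div 2)"
          and p = "Conj (rename (\<lambda>i. 2 * i) p) (rename (\<lambda>i. 2 * i + 1) q)"])
      (simp add: sat_rename p q)
qed

lemma definable_All_env:
  assumes "definable P" shows "definable (\<lambda>e. \<forall>a. P (case_nat a e))"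
proof -
  obtain p g where p: "\<And>e. P e \<longleftrightarrow> sat (\<lambda>i. case_sum e id (g i)) p"
    using assms unfolding definable_def by blast
  define f where "f i = (if g i = Inl 0 then 0 else Suc i)" for i
  \<comment> \<open>All occurrences of the bound variable become 0; the other variables move up by one.\<close>
  define h where "h i = (case g i of Inl j \<Rightarrow> Inl (j - 1) | Inr v \<Rightarrow> Inr v)" for i
  have "(\<lambda>i. case_sum (case_nat a e) id (g i))
      = (\<lambda>i. case_nat a (\<lambda>i. case_sum e id (h i)) (f i))" for a e
    by (auto simp: f_def h_def fun_eq_iff split: nat.split sum.split)
  then show ?thesis
    by (intro definableI[where g = h and p = "All (rename f p)"]) (simp add: sat_rename p)
qed

lemma definable_shift:
  assumes "definable P" shows "definable (\<lambda>e. P (\<lambda>i. e (f i)))"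
proof -
  obtain p g where p: "\<And>e. P e \<longleftrightarrow> sat (\<lambda>i. case_sum e id (g i)) p"
    using assms unfolding definable_def by blast
  have "(\<lambda>i. case_sum (\<lambda>i. e (f i)) id (g i)) = (\<lambda>i. case_sum e id (map_sum f id (g i)))" for e
    by (auto simp: fun_eq_iff split: sum.split)
  then show ?thesis
    by (intro definableI[where g = "\<lambda>i. map_sum f id (g i)" and p = p]) (simp add: p)
qed

text \<open>
  In the rules below a bound variable is moved to position 0 of the environment, so that resolution
  with \<open>definable_intro\<close> decomposes any predicate written with HOL connectives and quantifiers.
\<close>

lemma definable_all [definable_intro]:
  assumes "definable (\<lambda>e. Q (e 0) (\<lambda>i. e (Suc i)))" shows "definable (\<lambda>e. \<forall>a. Q a e)"
  using definable_All_env[OF assms] by simp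

lemma definable_ex [definable_intro]:
  assumes "definable (\<lambda>e. Q (e 0) (\<lambda>i. e (Suc i)))" shows "definable (\<lambda>e. \<exists>a. Q a e)"
  using definable_not[OF definable_all[of "\<lambda>a e. \<not> Q a e", OF definable_not[OF assms]]] by simp

lemma definable_disj [definable_intro]:
  assumes "definable P" "definable Q" shows "definable (\<lambda>e. P e \<or> Q e)"
  using definable_not[OF definable_conj[OF definable_not[OF assms(1)] definable_not[OF assms(2)]]]
  by simp

lemma definable_imp [definable_intro]:
  assumes "definable P" "definable Q" shows "definable (\<lambda>e. P e \<longrightarrow> Q e)"
  using definable_disj[OF definable_not[OF assms(1)] assms(2)] by simp

lemma definable_iff [definable_intro]:
  assumes "definable P" "definable Q" shows "definable (\<lambda>e. P e \<longleftrightarrow> Q e)"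
  using definable_conj[OF definable_imp[OF assms] definable_imp[OF assms(2,1)]]
  by (rule definable_cong) blast

lemma definable_var [definable_intro]: "definable_term (\<lambda>e. e i)"
  unfolding definable_term_def
  by (rule definableI[where g = "case_nat (Inl 0) (\<lambda>_. Inl (Suc i))" and p = "Equal 0 1"]) simp

lemma definable_const [definable_intro]: "definable_term (\<lambda>e. c)"
  unfolding definable_term_def
  by (rule definableI[where g = "case_nat (Inl 0) (\<lambda>_. Inr c)" and p = "Equal 0 1"]) simp

text \<open>
  A definable term is eliminated by quantifying over its value.
\<close>

lemma definable_subst:
  assumes "definable (\<lambda>e. Q (e 0) (\<lambda>i. e (Suc i)))" "definable_term t"
  shows "definable (\<lambda>e. Q (t e) e)"
  using definable_ex[OF definable_conj[OF assms(2)[unfolded definable_term_def] assms(1)]]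
  by simp

lemma definable_subst1:
  assumes "definable (\<lambda>e. R (e 0))" "definable_term t"
  shows "definable (\<lambda>e. R (t e))"
  by (rule definable_subst[OF assms])

lemma definable_term_shift:
  assumes "definable_term t" shows "definable_term (\<lambda>e. t (\<lambda>i. e (f i)))"
  using definable_shift[OF assms[unfolded definable_term_def], of "case_nat 0 (\<lambda>i. Suc (f i))"]
  unfolding definable_term_def by simp

lemma definable_subst2:
  assumes "definable (\<lambda>e. R (e 0) (e (Suc 0)))" "definable_term t" "definable_term u"
  shows "definable (\<lambda>e. R (t e) (u e))"
proof -
  have "definable (\<lambda>e. R (t (\<lambda>i. e (Suc i))) (e 0))"
    using definable_subst[of "\<lambda>a e. R a (e 0)", OF assms(1) definable_term_shift[OF assms(2)]] .
  from definable_subst[of "\<lambda>a e. R (t e) a", OF this assms(3)] show ?thesis .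
qed

lemma definable_subst3:
  assumes "definable (\<lambda>e. R (e 0) (e (Suc 0)) (e (Suc (Suc 0))))"
    "definable_term t" "definable_term u" "definable_term v"
  shows "definable (\<lambda>e. R (t e) (u e) (v e))"
proof -
  have "definable (\<lambda>e. R (t (\<lambda>i. e (Suc i))) (u (\<lambda>i. e (Suc i))) (e 0))"
  proof -
    have "definable (\<lambda>e. R (t (\<lambda>i. e (Suc (Suc i)))) (e 0) (e (Suc 0)))"
      using definable_subst[of "\<lambda>a e. R a (e 0) (e (Suc 0))",
          OF assms(1) definable_term_shift[OF assms(2), of "\<lambda>i. Suc (Suc i)"]] .
    from definable_subst[of "\<lambda>a e. R (t (\<lambda>i. e (Suc i))) a (e 0)",
        OF this definable_term_shift[OF assms(3)]] show ?thesis .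
  qed
  from definable_subst[of "\<lambda>a e. R (t e) (u e) a", OF this assms(4)] show ?thesis .
qed

lemma definable_eq [definable_intro]:
  "definable_term t \<Longrightarrow> definable_term u \<Longrightarrow> definable (\<lambda>e. t e = u e)"
  by (rule definable_subst2[of "(=)"],
      rule definableI[where g = Inl and p = "Equal 0 1"]) simp_all

lemma definable_mem [definable_intro]:
  "definable_term t \<Longrightarrow> definable_term u \<Longrightarrow> definable (\<lambda>e. t e \<in> elts (u e))"
  by (rule definable_subst2[of "\<lambda>x y. x \<in> elts y"],
      rule definableI[where g = Inl and p = "Mem 0 1"]) (simp_all add: elts_def)

lemma definable_ex1 [definable_intro]:
  assumes "definable (\<lambda>e. Q (e 0) (\<lambda>i. e (Suc i)))" shows "definable (\<lambda>e. \<exists>!a. Q a e)"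
  unfolding Ex1_def
proof (rule definable_ex, rule definable_conj, rule assms, rule definable_all, rule definable_imp)
  show "definable (\<lambda>e. Q (e 0) (\<lambda>i. e (Suc (Suc i))))"
    using definable_shift[OF assms, of "case_nat 0 (\<lambda>i. Suc (Suc i))"] by simp
qed (intro definable_intro)

lemma definable_ball [definable_intro]:
  assumes "definable_term t" "definable (\<lambda>e. Q (e 0) (\<lambda>i. e (Suc i)))"
  shows "definable (\<lambda>e. \<forall>a\<in>elts (t e). Q a e)"
  unfolding Ball_def
  by (rule definable_all, rule definable_imp, rule definable_mem, rule definable_var,
      rule definable_term_shift, rule assms(1), rule assms(2))

lemma definable_bex [definable_intro]:
  assumes "definable_term t" "definable (\<lambda>e. Q (e 0) (\<lambda>i. e (Suc i)))"
  shows "definable (\<lambda>e. \<exists>a\<in>elts (t e). Q a e)"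
  unfolding Bex_def
  by (rule definable_ex, rule definable_conj, rule definable_mem, rule definable_var,
      rule definable_term_shift, rule assms(1), rule assms(2))

lemma definable_subset [definable_intro]:
  "definable_term t \<Longrightarrow> definable_term u \<Longrightarrow> definable (\<lambda>e. elts (t e) \<subseteq> elts (u e))"
  unfolding subset_iff
  by (rule definable_all, rule definable_imp; rule definable_mem, rule definable_var,
      rule definable_term_shift, assumption)

lemma definable_elts_eq [definable_intro]:
  assumes "definable_term t" "definable (\<lambda>e. Q (e 0) (\<lambda>i. e (Suc i)))"
  shows "definable (\<lambda>e. elts (t e) = {a. Q a e})"
  unfolding set_eq_iff mem_Collect_eq
  by (rule definable_all, rule definable_iff, rule definable_mem, rule definable_var,
      rule definable_term_shift, rule assms(1), rule assms(2))

end

context zf_model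
begin

lemma definable_opair [definable_intro]:
  assumes "definable_term t" "definable_term u"
  shows "definable_term (\<lambda>e. opair (t e) (u e))"
proof -
  have upair: "z = upair a b \<longleftrightarrow> elts z = {x. x = a \<or> x = b}" for z a b
    using extensionality[of z "upair a b"] by (auto simp: elts_upair)
  have "z = opair a b \<longleftrightarrow> (\<exists>c d. c = upair a a \<and> d = upair a b \<and> z = upair c d)" for z a b
    by (simp add: opair_def)
  then have "definable (\<lambda>e. e 0 = opair (e (Suc 0)) (e (Suc (Suc 0))))"
    unfolding upair by (simp only:) (intro definable_intro)
  from definable_subst3[of "\<lambda>z a b. z = opair a b", OF this definable_var
      definable_term_shift[OF assms(1)] definable_term_shift[OF assms(2)]]
  show ?thesis unfolding definable_term_def .
qed

text \<open>
  The axiom schemes in semantic form: a definability condition replaces the formula.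
\<close>

lemma Separation:
  assumes "definable (\<lambda>e. P (e 0))"
  obtains y where "elts y = {z \<in> elts x. P z}"
proof -
  obtain p g where p: "\<And>e :: nat \<Rightarrow> 'a. P (e 0) \<longleftrightarrow> sat (\<lambda>i. case_sum e id (g i)) p"
    using assms unfolding definable_def by blast
  define f where "f i = (if g i = Inl 0 then 0 else Suc i)" for i
  define r where "r i = case_sum (\<lambda>_. x) id (g i)" for i
  have "(\<lambda>i. case_sum (case_nat z (\<lambda>_. x)) id (g i)) = (\<lambda>i. case_nat z r (f i))" for z
    by (auto simp: f_def r_def fun_eq_iff split: nat.split sum.split)
  then have "P z \<longleftrightarrow> sat (case_nat z r) (rename f p)" for z
    using p[of "case_nat z (\<lambda>_. x)"] by (simp add: sat_rename)
  then show ?thesis using separation[of x r "rename f p"] that by auto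
qed

lemma Replacement:
  assumes "definable (\<lambda>e. R (e 0) (e (Suc 0)))"
    and "\<And>x y y'. x \<in> elts a \<Longrightarrow> R x y \<Longrightarrow> R x y' \<Longrightarrow> y = y'"
  obtains b where "elts b = {y. \<exists>x\<in>elts a. R x y}"
proof -
  obtain p g where p: "\<And>e :: nat \<Rightarrow> 'a. R (e 0) (e (Suc 0)) \<longleftrightarrow> sat (\<lambda>i. case_sum e id (g i)) p"
    using assms(1) unfolding definable_def by blast
  \<comment> \<open>Positions 0 and 1 hold the two arguments of \<open>R\<close>, the rest holds parameters.\<close>
  define f where "f i = (if g i = Inl 0 then 0 else if g i = Inl 1 then 1 else Suc (Suc i))" for i
  define r where "r i = case_sum (\<lambda>_. a) id (g i)" for i
  have "(\<lambda>i. case_sum (case_nat x (case_nat y (\<lambda>_. a))) id (g i))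
      = (\<lambda>i. case_nat x (case_nat y r) (f i))" for x y
    by (auto simp: f_def r_def fun_eq_iff split: nat.split sum.split)
  then have "R x y \<longleftrightarrow> sat (case_nat x (case_nat y r)) (rename f p)" for x y
    using p[of "case_nat x (case_nat y (\<lambda>_. a))"] by (simp add: sat_rename)
  then show ?thesis using replacement[of a r "rename f p"] assms(2) that by auto
qed

section \<open>Functions and bijections\<close>

lemma ext_iff: "x = y \<longleftrightarrow> elts x = elts y"
  using extensionality by blast

lemma app_eqI:
  assumes "fun_on f A" "opair x y \<in> elts f" shows "x \<in> elts A" "app f x = y"
proof -
  show "x \<in> elts A" using assms by (auto simp: fun_on_def opair_eq_iff)
  then show "app f x = y" using assms app_eq by blast
qed

text \<open>
  The HOL function \<open>F\<close> need only agree on \<open>A\<close> with a definable relation.  It may therefore be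
  given by a HOL description or choice, which need not be definable in the model.
\<close>

lemma function_exists:
  assumes R: "definable (\<lambda>e. R (e 0) (e (Suc 0)))"
    and F: "\<And>x y. x \<in> elts A \<Longrightarrow> R x y \<longleftrightarrow> F x = y"
  obtains f where "fun_on f A" "\<And>x. x \<in> elts A \<Longrightarrow> app f x = F x"
proof -
  have "definable (\<lambda>e. \<exists>y. R (e 0) y \<and> e (Suc 0) = opair (e 0) y)"
    by (intro definable_intro definable_subst2[OF R])
  from Replacement[of "\<lambda>x p. \<exists>y. R x y \<and> p = opair x y", OF this, of A]
  obtain f where "elts f = {p. \<exists>x\<in>elts A. \<exists>y. R x y \<and> p = opair x y}"
    using F by metis
  then have f: "p \<in> elts f \<longleftrightarrow> (\<exists>x\<in>elts A. p = opair x (F x))" for p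
    using F by auto
  have "fun_on f A" unfolding fun_on_def by (auto simp: f opair_eq_iff)
  moreover have "app f x = F x" if "x \<in> elts A" for x
    using app_eq[OF calculation that] that by (auto simp: f)
  ultimately show ?thesis using that by blast
qed

lemma family_exists:
  assumes R: "definable (\<lambda>e. R (e 0) (e (Suc 0)))"
  obtains F where "fun_on F J" "\<And>j. j \<in> elts J \<Longrightarrow> elts (app F j) = {x \<in> elts A. R j x}"
proof -
  define S where "S j = (THE z. elts z = {x \<in> elts A. R j x})" for j
  have S: "elts (S j) = {x \<in> elts A. R j x}" for j
  proof -
    have "definable (\<lambda>e. R j (e 0))" by (intro definable_intro definable_subst2[OF R])
    from Separation[of "R j", OF this] obtain z where z: "elts z = {x \<in> elts A. R j x}" by blast
    show ?thesis unfolding S_def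
      by (rule theI[of "\<lambda>z. elts z = {x \<in> elts A. R j x}", OF z]) (simp add: ext_iff z)
  qed
  have "definable (\<lambda>e. elts (e (Suc 0)) = {x. x \<in> elts A \<and> R (e 0) x})"
    by (intro definable_intro definable_subst2[OF R])
  from function_exists[of "\<lambda>j z. elts z = {x \<in> elts A. R j x}", OF this, of J S]
  obtain F where "fun_on F J" "\<And>j. j \<in> elts J \<Longrightarrow> app F j = S j"
    using S by (metis ext_iff)
  then show ?thesis using that S by simp
qed

lemma definable_fun_on [definable_intro]:
  assumes "definable_term t" "definable_term u" shows "definable (\<lambda>e. fun_on (t e) (u e))"
proof -
  have "definable (\<lambda>e. fun_on (e 0) (e (Suc 0)))"
    unfolding fun_on_def by (intro definable_intro)
  from definable_subst2[OF this assms] show ?thesis .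
qed

lemma bij_betw_iff_ex1:
  "bij_betw F A B \<longleftrightarrow> (\<forall>x\<in>A. F x \<in> B) \<and> (\<forall>y\<in>B. \<exists>!x. x \<in> A \<and> F x = y)"
proof (intro iffI conjI ballI)
  assume F: "bij_betw F A B"
  show "F x \<in> B" if "x \<in> A" for x using F that bij_betwE by blast
  fix y assume "y \<in> B"
  then obtain x where "x \<in> A" "F x = y" using F unfolding bij_betw_def by blast
  then show "\<exists>!x. x \<in> A \<and> F x = y" using F unfolding bij_betw_def inj_on_def by blast
next
  assume F: "(\<forall>x\<in>A. F x \<in> B) \<and> (\<forall>y\<in>B. \<exists>!x. x \<in> A \<and> F x = y)"
  then have "inj_on F A" unfolding inj_on_def by blast
  moreover have "F ` A = B" using F by blast
  ultimately show "bij_betw F A B" unfolding bij_betw_def by blast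
qed

text \<open>
  The application function \<open>app\<close> is a definite description; the graph of \<open>f\<close> gives a
  description-free form, from which definability of \<open>equipotent\<close> can be read off.
\<close>

lemma equipotent_iff:
  "equipotent A B \<longleftrightarrow> (\<exists>f. fun_on f A \<and> (\<forall>x\<in>elts A. \<exists>y\<in>elts B. opair x y \<in> elts f)
     \<and> (\<forall>y\<in>elts B. \<exists>!x. x \<in> elts A \<and> opair x y \<in> elts f))"
proof -
  have "bij_betw (app f) (elts A) (elts B) \<longleftrightarrow> (\<forall>x\<in>elts A. \<exists>y\<in>elts B. opair x y \<in> elts f)
     \<and> (\<forall>y\<in>elts B. \<exists>!x. x \<in> elts A \<and> opair x y \<in> elts f)" if f: "fun_on f A" for f
  proof -
    have o: "opair x y \<in> elts f \<longleftrightarrow> x \<in> elts A \<and> app f x = y" for x y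
      using app_eq[OF f] app_eqI[OF f] by blast
    show ?thesis unfolding o bij_betw_iff_ex1 by blast
  qed
  then show ?thesis unfolding equipotent_def by blast
qed

lemma definable_equipotent [definable_intro]:
  assumes "definable_term t" "definable_term u" shows "definable (\<lambda>e. equipotent (t e) (u e))"
proof -
  have "definable (\<lambda>e. equipotent (e 0) (e (Suc 0)))"
    unfolding equipotent_iff by (intro definable_intro)
  from definable_subst2[OF this assms] show ?thesis .
qed

lemma equipotentI:
  assumes R: "definable (\<lambda>e. R (e 0) (e (Suc 0)))"
    and F: "\<And>x y. x \<in> elts A \<Longrightarrow> R x y \<longleftrightarrow> F x = y"
    and b: "bij_betw F (elts A) (elts B)"
  shows "equipotent A B"
proof -
  obtain f where f: "fun_on f A" "\<And>x. x \<in> elts A \<Longrightarrow> app f x = F x"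
    using function_exists[OF R F] by blast
  then have "bij_betw (app f) (elts A) (elts B)" using b bij_betw_cong by blast
  then show ?thesis using f(1) unfolding equipotent_def by blast
qed

lemma equipotent_refl: "equipotent A A"
proof -
  have "definable (\<lambda>e. e 0 = e (Suc 0))" by (intro definable_intro)
  from equipotentI[of "(=)", OF this, of A "\<lambda>x. x"] show ?thesis by (simp add: bij_betw_def)
qed

lemma equipotent_sym:
  assumes "equipotent A B" shows "equipotent B A"
proof -
  obtain f where f: "fun_on f A" "bij_betw (app f) (elts A) (elts B)"
    using assms unfolding equipotent_def by blast
  let ?g = "inv_into (elts A) (app f)"
  have g: "bij_betw ?g (elts B) (elts A)" using f(2) by (rule bij_betw_inv_into)
  have "opair y x \<in> elts f \<longleftrightarrow> ?g x = y" if "x \<in> elts B" for x y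
  proof
    assume "opair y x \<in> elts f"
    then show "?g x = y" using app_eqI[OF f(1)] f(2) by (metis bij_betw_inv_into_left)
  next
    assume "?g x = y"
    then have "y \<in> elts A" "app f y = x"
      using that f(2) g by (metis bij_betwE, metis bij_betw_inv_into_right)
    then show "opair y x \<in> elts f" using app_eq[OF f(1)] by blast
  qed
  moreover have "definable (\<lambda>e. opair (e (Suc 0)) (e 0) \<in> elts f)" by (intro definable_intro)
  ultimately show ?thesis
    using equipotentI[of "\<lambda>x y. opair y x \<in> elts f" B ?g A] g by blast
qed

lemma equipotent_trans:
  assumes "equipotent A B" "equipotent B C" shows "equipotent A C"
proof -
  obtain f where f: "fun_on f A" "bij_betw (app f) (elts A) (elts B)"
    using assms unfolding equipotent_def by blast
  obtain g where g: "fun_on g B" "bij_betw (app g) (elts B) (elts C)"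
    using assms unfolding equipotent_def by blast
  have d: "definable (\<lambda>e. \<exists>z. opair (e 0) z \<in> elts f \<and> opair z (e (Suc 0)) \<in> elts g)"
    by (intro definable_intro)
  show ?thesis
  proof (rule equipotentI[of "\<lambda>x y. \<exists>z. opair x z \<in> elts f \<and> opair z y \<in> elts g", OF d])
    show "bij_betw (\<lambda>x. app g (app f x)) (elts A) (elts C)"
      using bij_betw_trans[OF f(2) g(2)] by (simp add: comp_def)
    fix x y assume x: "x \<in> elts A"
    then have "app f x \<in> elts B" using f(2) bij_betwE by blast
    then show "(\<exists>z. opair x z \<in> elts f \<and> opair z y \<in> elts g) \<longleftrightarrow> app g (app f x) = y"
      using app_eq[OF f(1) x] app_eq[OF g(1)] by metis
  qed
qed

section \<open>Natural numbers of the model\<close>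

definition zero :: 'a where "zero = (THE z. elts z = {})"

definition adjoin :: "'a \<Rightarrow> 'a \<Rightarrow> 'a" where "adjoin x A = (THE z. elts z = insert x (elts A))"

abbreviation succ :: "'a \<Rightarrow> 'a" where "succ n \<equiv> adjoin n n"

lemma elts_zero [simp]: "elts zero = {}"
proof -
  obtain z where z: "elts z = {}" using infinity unfolding is_inductive_def by blast
  show ?thesis unfolding zero_def
    by (rule theI[of "\<lambda>z. elts z = {}", OF z]) (simp add: ext_iff z)
qed

lemma elts_adjoin [simp]: "elts (adjoin x A) = insert x (elts A)"
proof -
  obtain a where "elts a = {x, x}" using pairing by blast
  moreover obtain p where "elts p = {a, A}" using pairing by blast
  moreover obtain u where "elts u = (\<Union>y\<in>elts p. elts y)" using union by blast
  ultimately have u: "elts u = insert x (elts A)" by simp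
  show ?thesis unfolding adjoin_def
    by (rule theI[of "\<lambda>z. elts z = insert x (elts A)", OF u]) (simp add: ext_iff u)
qed

lemma definable_adjoin [definable_intro]:
  assumes "definable_term t" "definable_term u"
  shows "definable_term (\<lambda>e. adjoin (t e) (u e))"
proof -
  have "z = adjoin a b \<longleftrightarrow> elts z = {x. x = a \<or> x \<in> elts b}" for z a b
    by (auto simp: ext_iff)
  then have "definable (\<lambda>e. e 0 = adjoin (e (Suc 0)) (e (Suc (Suc 0))))"
    by (simp only:) (intro definable_intro)
  from definable_subst3[of "\<lambda>z a b. z = adjoin a b", OF this definable_var
      definable_term_shift[OF assms(1)] definable_term_shift[OF assms(2)]]
  show ?thesis unfolding definable_term_def .
qed

lemma zero_omega [simp]: "zero \<in> elts omega"
  using omega_least_inductive unfolding is_inductive_def by (metis ext_iff elts_zero)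

lemma succ_omega [simp]: "n \<in> elts omega \<Longrightarrow> succ n \<in> elts omega"
  using omega_least_inductive unfolding is_inductive_def by (metis ext_iff elts_adjoin)

lemma omega_induct:
  assumes "n \<in> elts omega" "definable (\<lambda>e. P (e 0))"
    and "P zero" "\<And>n. n \<in> elts omega \<Longrightarrow> P n \<Longrightarrow> P (succ n)"
  shows "P n"
proof -
  obtain y where y: "elts y = {z \<in> elts omega. P z}" using Separation[OF assms(2)] by blast
  have "is_inductive y" unfolding is_inductive_def y
  proof (intro conjI ballI)
    show "\<exists>z\<in>{z \<in> elts omega. P z}. elts z = {}" using assms(3) by (intro bexI[of _ zero]) auto
  next
    fix x assume "x \<in> {z \<in> elts omega. P z}"
    then show "\<exists>s\<in>{z \<in> elts omega. P z}. elts s = insert x (elts x)"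
      using assms(4) by (intro bexI[of _ "succ x"]) auto
  qed
  then show ?thesis using omega_least_inductive y assms(1) by auto
qed

lemma not_mem_self: "x \<notin> elts x"
  using foundation[of "adjoin x zero"] by auto

lemma mem_asym: "x \<in> elts y \<Longrightarrow> y \<notin> elts x"
  using foundation[of "adjoin x (adjoin y zero)"] by auto

lemma omega_cases:
  assumes "n \<in> elts omega" obtains "n = zero" | m where "m \<in> elts omega" "n = succ m"
proof -
  have "n = zero \<or> (\<exists>m\<in>elts omega. n = succ m)"
  proof (rule omega_induct[of n "\<lambda>n. n = zero \<or> (\<exists>m\<in>elts omega. n = succ m)", OF assms])
    show "definable (\<lambda>e. e 0 = zero \<or> (\<exists>m\<in>elts omega. e 0 = succ m))" by (intro definable_intro)
  qed auto
  then show ?thesis using that by blast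
qed

lemma mem_omega_imp_subset: "n \<in> elts omega \<Longrightarrow> elts n \<subseteq> elts omega"
proof (rule omega_induct[of n "\<lambda>n. elts n \<subseteq> elts omega"])
  show "definable (\<lambda>e. elts (e 0) \<subseteq> elts omega)" by (intro definable_intro)
qed auto

lemma omega_transitive: "m \<in> elts n \<Longrightarrow> n \<in> elts omega \<Longrightarrow> m \<in> elts omega"
  using mem_omega_imp_subset by blast

lemma nat_subset: "n \<in> elts omega \<Longrightarrow> m \<in> elts n \<Longrightarrow> elts m \<subseteq> elts n"
proof -
  assume n: "n \<in> elts omega" and m: "m \<in> elts n"
  have "\<forall>m\<in>elts n. elts m \<subseteq> elts n"
  proof (rule omega_induct[of n "\<lambda>n. \<forall>m\<in>elts n. elts m \<subseteq> elts n", OF n])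
    show "definable (\<lambda>e. \<forall>m\<in>elts (e 0). elts m \<subseteq> elts (e 0))" by (intro definable_intro)
  qed auto
  then show "elts m \<subseteq> elts n" using m by blast
qed

lemma nat_mem_trans: "k \<in> elts m \<Longrightarrow> m \<in> elts n \<Longrightarrow> n \<in> elts omega \<Longrightarrow> k \<in> elts n"
  using nat_subset by blast

lemma succ_le: 
  assumes "n \<in> elts omega" "m \<in> elts n" shows "succ m = n \<or> succ m \<in> elts n"
proof -
  have "\<forall>m\<in>elts n. succ m = n \<or> succ m \<in> elts n"
  proof (rule omega_induct[of n "\<lambda>n. \<forall>m\<in>elts n. succ m = n \<or> succ m \<in> elts n", OF assms(1)])
    show "definable (\<lambda>e. \<forall>m\<in>elts (e 0). succ m = e 0 \<or> succ m \<in> elts (e 0))"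
      by (intro definable_intro)
  qed auto
  then show ?thesis using assms by blast
qed

lemma nat_linear:
  assumes "m \<in> elts omega" "n \<in> elts omega"
  shows "m \<in> elts n \<or> m = n \<or> n \<in> elts m"
proof -
  have z: "zero = k \<or> zero \<in> elts k" if "k \<in> elts omega" for k
  proof (rule omega_induct[of k "\<lambda>k. zero = k \<or> zero \<in> elts k", OF that])
    show "definable (\<lambda>e. zero = e 0 \<or> zero \<in> elts (e 0))" by (intro definable_intro)
  qed auto
  show ?thesis
  proof (rule omega_induct[of m "\<lambda>m. m \<in> elts n \<or> m = n \<or> n \<in> elts m", OF assms(1)])
    show "definable (\<lambda>e. e 0 \<in> elts n \<or> e 0 = n \<or> n \<in> elts (e 0))" by (intro definable_intro)
    show "zero \<in> elts n \<or> zero = n \<or> n \<in> elts zero" using z assms(2) by blast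
  qed (use succ_le assms(2) in auto)
qed

text \<open>
  Foundation yields a member of the set disjoint from the set, and by linearity it is the least one.
\<close>

lemma nat_least:
  assumes "definable (\<lambda>e. P (e 0))" "n \<in> elts omega" "P n"
  shows "\<exists>m\<in>elts omega. P m \<and> (\<forall>k\<in>elts omega. P k \<longrightarrow> m = k \<or> m \<in> elts k)"
proof -
  obtain y where y: "elts y = {z \<in> elts omega. P z}" using Separation[OF assms(1)] by blast
  then obtain m where "m \<in> elts y" "elts y \<inter> elts m = {}" using foundation[of y] assms by blast
  then show ?thesis using nat_linear[of m] y by (intro bexI[of _ m]) auto
qed

section \<open>Finite sets\<close>

lemma definable_fin [definable_intro]:
  assumes "definable_term t" shows "definable (\<lambda>e. fin (t e))"
proof -
  have "definable (\<lambda>e. fin (e 0))" unfolding fin_def by (intro definable_intro)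
  from definable_subst1[OF this assms] show ?thesis .
qed

lemma equipotent_zero_iff: "equipotent A zero \<longleftrightarrow> A = zero"
proof
  show "equipotent A zero \<Longrightarrow> A = zero" by (auto simp: equipotent_def ext_iff bij_betw_def)
qed (simp add: equipotent_refl)

text \<open>
  The point that is mapped to \<open>b\<close> is redirected to the image of \<open>a\<close>.  This is the step that
  makes cardinalities of finite sets unique.
\<close>

lemma bij_betw_remove:
  assumes b: "bij_betw G (insert a A) (insert b B)" "a \<notin> A" "b \<notin> B"
  shows "bij_betw (\<lambda>x. if G x = b then G a else G x) A B"
proof -
  have i: "inj_on G (insert a A)" and m: "G ` insert a A = insert b B"
    using b(1) by (auto simp: bij_betw_def)
  have "inj_on (\<lambda>x. if G x = b then G a else G x) A"
    using i b(2) by (auto simp: inj_on_def)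
  moreover have "(if G x = b then G a else G x) \<in> B" if "x \<in> A" for x
  proof (cases "G x = b")
    case True
    then have "G a \<noteq> b" using i that b(2) by (auto simp: inj_on_def)
    then show ?thesis using m True by auto
  next
    case False
    then show ?thesis using m that by auto
  qed
  moreover have "y \<in> (\<lambda>x. if G x = b then G a else G x) ` A" if y: "y \<in> B" for y
  proof (cases "y = G a")
    case True
    then have "G a \<noteq> b" using b(3) y by blast
    moreover have "b \<in> G ` insert a A" using m by blast
    ultimately obtain x where "x \<in> A" "G x = b" by blast
    then show ?thesis using True by (intro image_eqI[of _ _ x]) auto
  next
    case False
    moreover have "y \<in> G ` insert a A" using m y by blast
    ultimately obtain x where "x \<in> A" "G x = y" by blast
    then show ?thesis using b(3) y by (intro image_eqI[of _ _ x]) auto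
  qed
  ultimately show ?thesis unfolding bij_betw_def by blast
qed

lemma equipotent_remove:
  assumes "equipotent (adjoin a A) (adjoin b B)" "a \<notin> elts A" "b \<notin> elts B"
  shows "equipotent A B"
proof -
  obtain g where g: "fun_on g (adjoin a A)" "bij_betw (app g) (elts (adjoin a A)) (elts (adjoin b B))"
    using assms unfolding equipotent_def by blast
  have d: "definable (\<lambda>e. (opair (e 0) b \<in> elts g \<and> opair a (e (Suc 0)) \<in> elts g)
      \<or> (opair (e 0) b \<notin> elts g \<and> opair (e 0) (e (Suc 0)) \<in> elts g))"
    by (intro definable_intro)
  show ?thesis
  proof (rule equipotentI[OF d])
    show "bij_betw (\<lambda>x. if app g x = b then app g a else app g x) (elts A) (elts B)"
      using bij_betw_remove g(2) assms by simp
    show "(opair x b \<in> elts g \<and> opair a y \<in> elts g \<or> opair x b \<notin> elts g \<and> opair x y \<in> elts g)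
        \<longleftrightarrow> (if app g x = b then app g a else app g x) = y" if "x \<in> elts A" for x y
      using app_eq[OF g(1), of x] app_eq[OF g(1), of a] that by auto
  qed
qed

lemma equipotent_adjoin:
  assumes "equipotent A B" "a \<notin> elts A" "b \<notin> elts B"
  shows "equipotent (adjoin a A) (adjoin b B)"
proof -
  obtain g where g: "fun_on g A" "bij_betw (app g) (elts A) (elts B)"
    using assms unfolding equipotent_def by blast
  have d: "definable (\<lambda>e. opair (e 0) (e (Suc 0)) \<in> elts g \<or> e 0 = a \<and> e (Suc 0) = b)"
    by (intro definable_intro)
  let ?F = "\<lambda>x. if x = a then b else app g x"
  show ?thesis
  proof (rule equipotentI[OF d])
    have "bij_betw ?F (elts A) (elts B)"
      using g(2) assms(2) by (subst bij_betw_cong[of _ _ "app g"]) auto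
    then show "bij_betw ?F (elts (adjoin a A)) (elts (adjoin b B))"
      using notIn_Un_bij_betw[of a "elts A" ?F "elts B"] assms by simp
    show "(opair x y \<in> elts g \<or> x = a \<and> y = b) \<longleftrightarrow> ?F x = y" if "x \<in> elts (adjoin a A)" for x y
      using app_eq[OF g(1), of x] app_eqI[OF g(1), of x y] that assms(2) by auto
  qed
qed

lemma remove_exists:
  assumes "a \<in> elts A" obtains A' where "A = adjoin a A'" "a \<notin> elts A'"
proof -
  have "definable (\<lambda>e. e 0 \<noteq> a)" by (intro definable_intro)
  then obtain A' where "elts A' = {x \<in> elts A. x \<noteq> a}"
    using Separation[of "\<lambda>x. x \<noteq> a"] by blast
  then have "elts A = elts (adjoin a A')" "a \<notin> elts A'" using assms by auto
  then show ?thesis using that extensionality by blast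
qed

lemma equipotent_succE:
  assumes "equipotent A (succ n)"
  obtains a A' where "A = adjoin a A'" "a \<notin> elts A'" "equipotent A' n"
proof -
  obtain f where "bij_betw (app f) (elts A) (elts (succ n))"
    using assms unfolding equipotent_def by blast
  then obtain a where "a \<in> elts A" unfolding bij_betw_def by auto
  then obtain A' where A': "A = adjoin a A'" "a \<notin> elts A'" by (rule remove_exists)
  then show ?thesis using equipotent_remove[of a A' n n] assms not_mem_self that by blast
qed

lemma fin_zero [simp]: "fin zero"
  unfolding fin_def using equipotent_refl zero_omega by blast

lemma fin_adjoin: "fin A \<Longrightarrow> fin (adjoin x A)"
proof (cases "x \<in> elts A")
  case True
  then have "adjoin x A = A" by (auto simp: ext_iff)
  then show "fin A \<Longrightarrow> fin (adjoin x A)" by simp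
next
  case False
  then show "fin A \<Longrightarrow> fin (adjoin x A)"
    unfolding fin_def using equipotent_adjoin not_mem_self succ_omega by meson
qed

lemma fin_induct:
  assumes "fin A" and P: "definable (\<lambda>e. P (e 0))"
    and "P zero" "\<And>A x. fin A \<Longrightarrow> P A \<Longrightarrow> x \<notin> elts A \<Longrightarrow> P (adjoin x A)"
  shows "P A"
proof -
  obtain n where n: "n \<in> elts omega" "equipotent A n" using assms(1) fin_def by blast
  have "\<forall>A. equipotent A n \<longrightarrow> fin A \<and> P A"
  proof (rule omega_induct[of n "\<lambda>n. \<forall>A. equipotent A n \<longrightarrow> fin A \<and> P A", OF n(1)])
    show "definable (\<lambda>e. \<forall>A. equipotent A (e 0) \<longrightarrow> fin A \<and> P A)"
      by (intro definable_intro definable_subst1[OF P])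
    show "\<forall>A. equipotent A zero \<longrightarrow> fin A \<and> P A" using assms(3) by (simp add: equipotent_zero_iff)
  next
    fix n assume IH: "\<forall>A. equipotent A n \<longrightarrow> fin A \<and> P A"
    show "\<forall>A. equipotent A (succ n) \<longrightarrow> fin A \<and> P A"
      using equipotent_succE[of _ n] IH assms(4) fin_adjoin by metis
  qed
  then show ?thesis using n(2) by blast
qed

lemma card_unique:
  assumes "m \<in> elts omega" "n \<in> elts omega" "equipotent m n" shows "m = n"
proof -
  have "\<forall>m\<in>elts omega. equipotent m n \<longrightarrow> m = n"
  proof (rule omega_induct[of n "\<lambda>n. \<forall>m\<in>elts omega. equipotent m n \<longrightarrow> m = n", OF assms(2)])
    show "definable (\<lambda>e. \<forall>m\<in>elts omega. equipotent m (e 0) \<longrightarrow> m = e 0)"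
      by (intro definable_intro)
    show "\<forall>m\<in>elts omega. equipotent m zero \<longrightarrow> m = zero" by (simp add: equipotent_zero_iff)
  next
    fix n assume IH: "\<forall>m\<in>elts omega. equipotent m n \<longrightarrow> m = n"
    show "\<forall>m\<in>elts omega. equipotent m (succ n) \<longrightarrow> m = succ n"
    proof (intro ballI impI)
      fix m assume m: "m \<in> elts omega" "equipotent m (succ n)"
      show "m = succ n"
      proof (rule omega_cases[OF m(1)])
        assume "m = zero"
        then have "equipotent (succ n) zero" using m(2) equipotent_sym by blast
        then show ?thesis using equipotent_zero_iff by (auto simp: ext_iff)
      next
        fix k assume k: "k \<in> elts omega" "m = succ k"
        then have "equipotent k n" using m(2) equipotent_remove not_mem_self by blast
        then show ?thesis using IH k by blast
      qed
    qed
  qed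
  then show ?thesis using assms by blast
qed

text \<open>
  The pigeonhole principle together with finiteness of subsets: proving both in one induction on the
  cardinality of \<open>A\<close> gives the strict bound for proper subsets.
\<close>

lemma card_subset:
  assumes "n \<in> elts omega" "equipotent A n" "elts B \<subseteq> elts A"
  shows "\<exists>m\<in>elts omega. equipotent B m \<and> (m \<in> elts n \<or> m = n \<and> B = A)"
proof -
  let ?P = "\<lambda>n. \<forall>A B. equipotent A n \<longrightarrow> elts B \<subseteq> elts A \<longrightarrow>
    (\<exists>m\<in>elts omega. equipotent B m \<and> (m \<in> elts n \<or> m = n \<and> B = A))"
  have "?P n"
  proof (rule omega_induct[of n ?P, OF assms(1)])
    show "definable (\<lambda>e. \<forall>A B. equipotent A (e 0) \<longrightarrow> elts B \<subseteq> elts A \<longrightarrow>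
      (\<exists>m\<in>elts omega. equipotent B m \<and> (m \<in> elts (e 0) \<or> m = e 0 \<and> B = A)))"
      by (intro definable_intro)
    show "?P zero"
    proof (intro allI impI)
      fix A B assume "equipotent A zero" "elts B \<subseteq> elts A"
      then have "A = zero" "B = zero" by (simp_all add: equipotent_zero_iff ext_iff)
      then show "\<exists>m\<in>elts omega. equipotent B m \<and> (m \<in> elts zero \<or> m = zero \<and> B = A)"
        using equipotent_refl zero_omega by blast
    qed
  next
    fix n assume n: "n \<in> elts omega" and IH: "?P n"
    show "?P (succ n)"
    proof (intro allI impI)
      fix A B assume A: "equipotent A (succ n)" and B: "elts B \<subseteq> elts A"
      obtain a A' where A': "A = adjoin a A'" "a \<notin> elts A'" "equipotent A' n"
        using A by (rule equipotent_succE)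
      show "\<exists>m\<in>elts omega. equipotent B m \<and> (m \<in> elts (succ n) \<or> m = succ n \<and> B = A)"
      proof (cases "a \<in> elts B")
        case True
        then obtain B' where B': "B = adjoin a B'" "a \<notin> elts B'" by (rule remove_exists)
        then have "elts B' \<subseteq> elts A'" using A' B by auto
        then obtain m where m: "m \<in> elts omega" "equipotent B' m" "m \<in> elts n \<or> m = n \<and> B' = A'"
          using IH A'(3) by blast
        then have "equipotent B (succ m)" using B' equipotent_adjoin not_mem_self by blast
        then show ?thesis using m succ_le[OF n, of m] A'(1) B'(1)
          by (intro bexI[of _ "succ m"]) auto
      next
        case False
        then have "elts B \<subseteq> elts A'" using A' B by auto
        then obtain m where "m \<in> elts omega" "equipotent B m" "m \<in> elts n \<or> m = n \<and> B = A'"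
          using IH A'(3) by blast
        then show ?thesis by auto
      qed
    qed
  qed
  then show ?thesis using assms by blast
qed

lemma fin_subset: "fin A \<Longrightarrow> elts B \<subseteq> elts A \<Longrightarrow> fin B"
  unfolding fin_def using card_subset by meson

lemma fin_nat: "n \<in> elts omega \<Longrightarrow> fin n"
  unfolding fin_def using equipotent_refl by blast

lemma not_fin_omega: "\<not> fin omega"
proof
  assume "fin omega"
  then obtain n where n: "n \<in> elts omega" "equipotent omega n" unfolding fin_def by blast
  have "elts (succ n) \<subseteq> elts omega" by (rule mem_omega_imp_subset[OF succ_omega[OF n(1)]])
  then obtain m where m: "m \<in> elts omega" "equipotent (succ n) m" "m \<in> elts n \<or> m = n"
    using card_subset[OF n] by meson
  then have "succ n = m" using card_unique[OF succ_omega[OF n(1)]] by blast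
  then have "m \<in> elts m" using m(3) elts_adjoin[of n n] by blast
  then show False using not_mem_self by blast
qed

lemma fin_union:
  assumes "fin A" "fin B" "elts C = elts A \<union> elts B" shows "fin C"
proof -
  have "\<forall>C. elts C = elts A \<union> elts B \<longrightarrow> fin C"
  proof (rule fin_induct[of A "\<lambda>A. \<forall>C. elts C = elts A \<union> elts B \<longrightarrow> fin C", OF assms(1)])
    have "definable (\<lambda>e. \<forall>C. elts C = {x. x \<in> elts (e 0) \<or> x \<in> elts B} \<longrightarrow> fin C)"
      by (intro definable_intro)
    then show "definable (\<lambda>e. \<forall>C. elts C = elts (e 0) \<union> elts B \<longrightarrow> fin C)" by (simp add: Un_def)
    show "\<forall>C. elts C = elts zero \<union> elts B \<longrightarrow> fin C" using assms(2) by (metis ext_iff Un_empty_left elts_zero)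
  next
    fix A x assume IH: "\<forall>C. elts C = elts A \<union> elts B \<longrightarrow> fin C"
    show "\<forall>C. elts C = elts (adjoin x A) \<union> elts B \<longrightarrow> fin C"
    proof (intro allI impI)
      fix C assume C: "elts C = elts (adjoin x A) \<union> elts B"
      have "definable (\<lambda>e. e 0 \<in> elts A \<or> e 0 \<in> elts B)" by (intro definable_intro)
      then obtain D where D: "elts D = {z \<in> elts C. z \<in> elts A \<or> z \<in> elts B}"
        using Separation[of "\<lambda>z. z \<in> elts A \<or> z \<in> elts B"] by blast
      then have "fin D" using IH C by auto
      moreover have "C = adjoin x D" using C D by (auto simp: ext_iff)
      ultimately show "fin C" using fin_adjoin by blast
    qed
  qed
  then show ?thesis using assms by blast
qed

section \<open>Cardinalities of finite sets\<close>

definition card_of :: "'a \<Rightarrow> 'a" where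
  "card_of A = (THE n. n \<in> elts omega \<and> equipotent A n)"

lemma card_of_iff:
  assumes "fin A" shows "card_of A = n \<longleftrightarrow> n \<in> elts omega \<and> equipotent A n"
proof -
  obtain m where m: "m \<in> elts omega" "equipotent A m" using assms fin_def by blast
  have u: "k = m" if "k \<in> elts omega \<and> equipotent A k" for k
    using card_unique[of k m] that m equipotent_trans equipotent_sym by blast
  have "card_of A = m" unfolding card_of_def using u m by blast
  then show ?thesis using u m by blast
qed

lemma card_of_omega: "fin A \<Longrightarrow> card_of A \<in> elts omega"
  and equipotent_card_of: "fin A \<Longrightarrow> equipotent A (card_of A)"
  using card_of_iff[of A "card_of A"] by simp_all

lemma card_of_strict_mono:
  assumes "fin A" "elts B \<subset> elts A" shows "card_of B \<in> elts (card_of A)"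
proof -
  note A = card_of_omega[OF assms(1)] equipotent_card_of[OF assms(1)]
  obtain m where "m \<in> elts omega" "equipotent B m" "m \<in> elts (card_of A)"
    using card_subset[OF A, of B] assms(2) by blast
  then show ?thesis using card_of_iff[of B m] unfolding fin_def by blast
qed

lemma card_of_zero: "card_of zero = zero"
  by (simp add: card_of_iff equipotent_refl)

lemma card_of_adjoin:
  assumes "fin A" "x \<notin> elts A" shows "card_of (adjoin x A) = succ (card_of A)"
proof -
  have "equipotent (adjoin x A) (succ (card_of A))"
    using equipotent_adjoin equipotent_card_of[OF assms(1)] assms(2) not_mem_self by blast
  then show ?thesis
    using card_of_iff[OF fin_adjoin[OF assms(1)]] succ_omega[OF card_of_omega[OF assms(1)]] by blast
qed

text \<open>
  A linear order with finite initial segments embeds into \<open>omega\<close>: a point is mapped to the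
  number of its predecessors.  Counting predecessors takes the place of a recursive
  enumeration, and the recursion theorem inside the model is avoided.
\<close>

lemma rank_injection:
  assumes L: "definable (\<lambda>e. L (e 0) (e (Suc 0)))"
    and fin: "\<And>x z. x \<in> elts W \<Longrightarrow> elts z = {y \<in> elts W. L y x} \<Longrightarrow> fin z"
    and irrefl: "\<And>x. x \<in> elts W \<Longrightarrow> \<not> L x x"
    and trans: "\<And>x y z. x \<in> elts W \<Longrightarrow> y \<in> elts W \<Longrightarrow> z \<in> elts W \<Longrightarrow> L x y \<Longrightarrow> L y z \<Longrightarrow> L x z"
    and total: "\<And>x y. x \<in> elts W \<Longrightarrow> y \<in> elts W \<Longrightarrow> x = y \<or> L x y \<or> L y x"
  shows "\<exists>h. fun_on h W \<and> (\<forall>x\<in>elts W. app h x \<in> elts omega) \<and> inj_on (app h) (elts W)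
    \<and> (\<forall>x\<in>elts W. \<forall>z. elts z = {y \<in> elts W. L y x} \<longrightarrow> app h x = card_of z)"
proof -
  have "definable (\<lambda>e. L (e (Suc 0)) (e 0))" by (intro definable_subst2[OF L] definable_intro)
  from family_exists[of "\<lambda>x y. L y x", OF this, of W W]
  obtain S where S: "fun_on S W" "\<And>x. x \<in> elts W \<Longrightarrow> elts (app S x) = {y \<in> elts W. L y x}"
    by blast
  have finS: "fin (app S x)" if "x \<in> elts W" for x using fin[OF that S(2)[OF that]] .
  have d: "definable (\<lambda>e. e (Suc 0) \<in> elts omega
      \<and> (\<exists>z. opair (e 0) z \<in> elts S \<and> equipotent z (e (Suc 0))))"
    by (intro definable_intro)
  have iff: "(n \<in> elts omega \<and> (\<exists>z. opair x z \<in> elts S \<and> equipotent z n))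
      \<longleftrightarrow> card_of (app S x) = n" if "x \<in> elts W" for x n
  proof -
    have "(\<exists>z. opair x z \<in> elts S \<and> equipotent z n) \<longleftrightarrow> equipotent (app S x) n"
      using app_eq[OF S(1) that] by metis
    then show ?thesis using card_of_iff[OF finS[OF that]] by simp
  qed
  obtain h where h: "fun_on h W" "\<And>x. x \<in> elts W \<Longrightarrow> app h x = card_of (app S x)"
    using function_exists[of "\<lambda>x n. n \<in> elts omega \<and> (\<exists>z. opair x z \<in> elts S \<and> equipotent z n)",
        OF d iff] by blast
  have less: "app h x \<in> elts (app h y)" if xy: "x \<in> elts W" "y \<in> elts W" "L x y" for x y
  proof -
    have "v \<in> elts (app S y)" if "v \<in> elts (app S x)" for v
      using trans[of v x y] xy that S(2) by simp
    moreover have "x \<in> elts (app S y)" "x \<notin> elts (app S x)" using irrefl xy S(2) by simp_all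
    ultimately have "elts (app S x) \<subset> elts (app S y)" by blast
    then show ?thesis using card_of_strict_mono finS h(2) xy by simp
  qed
  have "inj_on (app h) (elts W)"
  proof (rule inj_onI)
    fix x y assume xy: "x \<in> elts W" "y \<in> elts W" "app h x = app h y"
    then show "x = y" using total[OF xy(1,2)] less[OF xy(1,2)] less[OF xy(2,1)] not_mem_self by auto
  qed
  moreover have "app h x \<in> elts omega" if "x \<in> elts W" for x
    using card_of_omega[OF finS[OF that]] h(2)[OF that] by simp
  moreover have "app h x = card_of z" if "x \<in> elts W" "elts z = {y \<in> elts W. L y x}" for x z
  proof -
    have "app S x = z" using S(2)[OF that(1)] that(2) by (simp add: ext_iff)
    then show ?thesis using h(2)[OF that(1)] by simp
  qed
  ultimately show ?thesis using h(1) by blast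
qed

section \<open>Countable sets\<close>

text \<open>
  If \<open>S\<close> is infinite, then counting predecessors is onto \<open>omega\<close>: when \<open>x\<close> has \<open>n\<close> predecessors in
  \<open>S\<close>, the next element of \<open>S\<close> after \<open>x\<close> has one more.
\<close>

lemma subset_omega_ctbl:
  assumes S: "elts S \<subseteq> elts omega" shows "ctbl S"
proof (cases "fin S")
  case False
  have d: "definable (\<lambda>e. e 0 \<in> elts (e (Suc 0)))" by (intro definable_intro)
  have "\<exists>h. fun_on h S \<and> (\<forall>x\<in>elts S. app h x \<in> elts omega) \<and> inj_on (app h) (elts S)
    \<and> (\<forall>x\<in>elts S. \<forall>z. elts z = {y \<in> elts S. y \<in> elts x} \<longrightarrow> app h x = card_of z)"
  proof (rule rank_injection[of "\<lambda>x y. x \<in> elts y" S, OF d])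
    show "fin z" if "x \<in> elts S" "elts z = {y \<in> elts S. y \<in> elts x}" for x z
      using fin_subset[of x z] fin_nat that S by blast
    show "x \<in> elts z" if "z \<in> elts S" "x \<in> elts y" "y \<in> elts z" for x y z
      using nat_mem_trans that S by blast
    show "x = y \<or> x \<in> elts y \<or> y \<in> elts x" if "x \<in> elts S" "y \<in> elts S" for x y
      using nat_linear that S by blast
  qed (rule not_mem_self)
  then obtain h where h: "fun_on h S" "\<forall>x\<in>elts S. app h x \<in> elts omega" "inj_on (app h) (elts S)"
    and card: "\<forall>x\<in>elts S. \<forall>z. elts z = {y \<in> elts S. y \<in> elts x} \<longrightarrow> app h x = card_of z"
    by blast
  have "\<exists>x\<in>elts S. app h x = n" if "n \<in> elts omega" for n
  proof -
    have "\<exists>x\<in>elts S. opair x n \<in> elts h"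
    proof (rule omega_induct[of n "\<lambda>n. \<exists>x\<in>elts S. opair x n \<in> elts h", OF that])
      show "definable (\<lambda>e. \<exists>x\<in>elts S. opair x (e 0) \<in> elts h)" by (intro definable_intro)
      have "definable (\<lambda>e. e 0 \<in> elts S)" by (intro definable_intro)
      moreover have "S \<noteq> zero" using False fin_zero by blast
      then obtain x0 where "x0 \<in> elts S" by (auto simp: ext_iff)
      ultimately have "\<exists>x\<in>elts omega. x \<in> elts S \<and>
          (\<forall>k\<in>elts omega. k \<in> elts S \<longrightarrow> x = k \<or> x \<in> elts k)"
        using S by (intro nat_least[of "\<lambda>x. x \<in> elts S" x0]) auto
      then obtain x where x: "x \<in> elts S" "\<forall>k\<in>elts S. x = k \<or> x \<in> elts k" using S by blast
      then have "elts zero = {y \<in> elts S. y \<in> elts x}" using mem_asym not_mem_self by auto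
      then have "app h x = card_of zero" using card x(1) by blast
      then show "\<exists>x\<in>elts S. opair x zero \<in> elts h" unfolding card_of_zero using app_eq[OF h(1)] x(1) by blast
    next
      fix n assume n: "n \<in> elts omega" "\<exists>x\<in>elts S. opair x n \<in> elts h"
      then obtain x where x: "x \<in> elts S" "app h x = n" using app_eq[OF h(1)] by blast
      have "\<not> elts S \<subseteq> elts (succ x)"
        using False fin_subset fin_nat[OF succ_omega[of x]] x(1) S by blast
      then obtain y0 where y0: "y0 \<in> elts S" "y0 \<noteq> x" "y0 \<notin> elts x" by auto
      have "definable (\<lambda>e. e 0 \<in> elts S \<and> e 0 \<noteq> x \<and> e 0 \<notin> elts x)" by (intro definable_intro)
      from nat_least[of "\<lambda>y. y \<in> elts S \<and> y \<noteq> x \<and> y \<notin> elts x", OF this, of y0]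
      obtain y where y: "y \<in> elts S" "y \<noteq> x" "y \<notin> elts x"
        "\<forall>k\<in>elts S. k \<noteq> x \<longrightarrow> k \<notin> elts x \<longrightarrow> y = k \<or> y \<in> elts k"
        using y0 S by (meson subsetD)
      have "definable (\<lambda>e. e 0 \<in> elts x)" by (intro definable_intro)
      from Separation[of "\<lambda>z. z \<in> elts x", OF this, of S]
      obtain z where z: "elts z = {y \<in> elts S. y \<in> elts x}" by blast
      have xy: "x \<in> elts y" using nat_linear[of x y] x(1) y S by blast
      have yo: "y \<in> elts omega" using y(1) S by blast
      have "v \<in> elts (adjoin x z) \<longleftrightarrow> v \<in> elts S \<and> v \<in> elts y" for v
        using nat_mem_trans[OF _ xy yo] xy y(4) x(1) z not_mem_self mem_asym by auto
      then have "elts (adjoin x z) = {v \<in> elts S. v \<in> elts y}" by blast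
      then have "app h y = card_of (adjoin x z)" using card y(1) by simp
      moreover have "fin z" using fin_subset[of x z] fin_nat z S x(1) by blast
      ultimately have "app h y = succ n"
        using card_of_adjoin[of z x] z not_mem_self card x z by simp
      then show "\<exists>x\<in>elts S. opair x (succ n) \<in> elts h" using app_eq[OF h(1)] y(1) by blast
    qed
    then show ?thesis using app_eq[OF h(1)] by blast
  qed
  then have "bij_betw (app h) (elts S) (elts omega)"
    using h(2,3) unfolding bij_betw_def by blast
  then show ?thesis using h(1) unfolding ctbl_def equipotent_def by blast
qed (simp add: ctbl_def)

lemma ctblI_injection:
  assumes j: "fun_on j W" "\<And>x. x \<in> elts W \<Longrightarrow> app j x \<in> elts omega" "inj_on (app j) (elts W)"
  shows "ctbl W"
proof -
  have "definable (\<lambda>e. \<exists>x\<in>elts W. opair x (e 0) \<in> elts j)" by (intro definable_intro)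
  from Separation[of "\<lambda>k. \<exists>x\<in>elts W. opair x k \<in> elts j", OF this]
  obtain S where S: "elts S = {k \<in> elts omega. \<exists>x\<in>elts W. opair x k \<in> elts j}" by blast
  have "elts S = app j ` elts W" unfolding S using j(2) by (auto simp: app_eq[OF j(1), symmetric])
  then have "equipotent W S" using j unfolding equipotent_def bij_betw_def by blast
  moreover have "ctbl S" by (rule subset_omega_ctbl) (auto simp: S)
  ultimately show ?thesis unfolding ctbl_def fin_def using equipotent_trans by blast
qed

lemma ctbl_injection:
  assumes "ctbl W"
  obtains j where "fun_on j W" "\<And>x. x \<in> elts W \<Longrightarrow> app j x \<in> elts omega" "inj_on (app j) (elts W)"
proof -
  obtain n where n: "elts n \<subseteq> elts omega" "equipotent W n"
    using assms mem_omega_imp_subset unfolding ctbl_def fin_def by blast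
  then obtain j where "fun_on j W" "bij_betw (app j) (elts W) (elts n)"
    unfolding equipotent_def by blast
  then show ?thesis using that n(1) bij_betwE bij_betw_imp_inj_on by blast
qed

text \<open>
  Each element of \<open>W\<close> is sent to its least code, which requires no choice.
\<close>

lemma ctblI_surjection:
  assumes R: "definable (\<lambda>e. R (e 0) (e (Suc 0)))"
    and ex: "\<And>y. y \<in> elts W \<Longrightarrow> \<exists>k\<in>elts omega. R k y"
    and un: "\<And>k y y'. R k y \<Longrightarrow> R k y' \<Longrightarrow> y = y'"
  shows "ctbl W"
proof -
  let ?Q = "\<lambda>y k. k \<in> elts omega \<and> R k y \<and> (\<forall>l\<in>elts omega. R l y \<longrightarrow> k = l \<or> k \<in> elts l)"
  have d: "definable (\<lambda>e. ?Q (e 0) (e (Suc 0)))" by (intro definable_intro definable_subst2[OF R])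
  have ex1: "\<exists>k. ?Q y k" if y: "y \<in> elts W" for y
  proof -
    have "definable (\<lambda>e. R (e 0) y)" by (intro definable_intro definable_subst2[OF R])
    from nat_least[of "\<lambda>k. R k y", OF this] show ?thesis using ex[OF y] by meson
  qed
  define F where "F y = (SOME k. ?Q y k)" for y
  have F: "?Q y (F y)" if "y \<in> elts W" for y
    unfolding F_def using ex1[OF that] by (rule someI_ex)
  have iff: "?Q y k \<longleftrightarrow> F y = k" if y: "y \<in> elts W" for y k
  proof
    assume k: "?Q y k"
    then have "F y = k \<or> F y \<in> elts k" "k = F y \<or> k \<in> elts (F y)" using F[OF y] by blast+
    then show "F y = k" using mem_asym by blast
  qed (use F[OF y] in blast)
  from function_exists[of ?Q, OF d iff]
  obtain j where j: "fun_on j W" "\<And>y. y \<in> elts W \<Longrightarrow> app j y = F y" by blast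
  have "inj_on F (elts W)"
  proof (rule inj_onI)
    fix x y assume "x \<in> elts W" "y \<in> elts W" "F x = F y"
    then show "x = y" using F un by metis
  qed
  then have "inj_on (app j) (elts W)" using j(2) by (simp cong: inj_on_cong)
  then show ?thesis using j F by (intro ctblI_injection[of j]) auto
qed

lemma ctbl_subset:
  assumes "ctbl W" "elts V \<subseteq> elts W" shows "ctbl V"
proof -
  obtain j where j: "fun_on j W" "\<And>x. x \<in> elts W \<Longrightarrow> app j x \<in> elts omega" "inj_on (app j) (elts W)"
    using ctbl_injection[OF assms(1)] by blast
  have "definable (\<lambda>e. opair (e (Suc 0)) (e 0) \<in> elts j)" by (intro definable_intro)
  then show ?thesis
  proof (rule ctblI_surjection)
    show "\<exists>k\<in>elts omega. opair y k \<in> elts j" if "y \<in> elts V" for y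
      using that assms(2) j(2) app_eq[OF j(1)] by blast
    show "y = y'" if "opair y k \<in> elts j" "opair y' k \<in> elts j" for k y y'
      using that app_eqI[OF j(1)] j(3) by (metis inj_onD)
  qed
qed

section \<open>Products\<close>

lemma product_exists:
  obtains P where "elts P = {p. \<exists>a b. a \<in> elts A \<and> b \<in> elts B \<and> p = opair a b}"
proof -
  have col: "\<exists>z. elts z = {p. \<exists>b. b \<in> elts B \<and> p = opair a b}" for a
  proof -
    have "definable (\<lambda>e. e (Suc 0) = opair a (e 0))" by (intro definable_intro)
    from Replacement[of "\<lambda>b p. p = opair a b", OF this, of B]
    show ?thesis unfolding Bex_def by metis
  qed
  have d: "definable (\<lambda>e. elts (e (Suc 0)) = {p. \<exists>b. b \<in> elts B \<and> p = opair (e 0) b})"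
    by (intro definable_intro)
  obtain S where S: "elts S = {z. \<exists>a\<in>elts A. elts z = {p. \<exists>b. b \<in> elts B \<and> p = opair a b}}"
  proof (rule Replacement[of "\<lambda>a z. elts z = {p. \<exists>b. b \<in> elts B \<and> p = opair a b}", OF d])
    show "\<And>a z z'. elts z = {p. \<exists>b. b \<in> elts B \<and> p = opair a b} \<Longrightarrow>
        elts z' = {p. \<exists>b. b \<in> elts B \<and> p = opair a b} \<Longrightarrow> z = z'" by (simp add: ext_iff)
  qed
  obtain P where P: "elts P = (\<Union>z\<in>elts S. elts z)" using union by blast
  have "p \<in> elts P \<longleftrightarrow> (\<exists>a b. a \<in> elts A \<and> b \<in> elts B \<and> p = opair a b)" for p
  proof
    assume "p \<in> elts P"
    then show "\<exists>a b. a \<in> elts A \<and> b \<in> elts B \<and> p = opair a b" unfolding P S by auto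
  next
    assume "\<exists>a b. a \<in> elts A \<and> b \<in> elts B \<and> p = opair a b"
    then obtain a b where ab: "a \<in> elts A" "b \<in> elts B" "p = opair a b" by blast
    obtain z where "elts z = {p. \<exists>b. b \<in> elts B \<and> p = opair a b}" using col by blast
    then show "p \<in> elts P" unfolding P S using ab by auto
  qed
  then show ?thesis using that by blast
qed

lemma fin_product:
  assumes "fin A" "fin B" "elts P = {p. \<exists>a b. a \<in> elts A \<and> b \<in> elts B \<and> p = opair a b}"
  shows "fin P"
proof -
  let ?prod = "\<lambda>A P. elts P = {p. \<exists>a b. a \<in> elts A \<and> b \<in> elts B \<and> p = opair a b}"
  have "\<forall>P. ?prod A P \<longrightarrow> fin P"
  proof (rule fin_induct[of A "\<lambda>A. \<forall>P. ?prod A P \<longrightarrow> fin P", OF assms(1)])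
    show "definable (\<lambda>e. \<forall>P. ?prod (e 0) P \<longrightarrow> fin P)" by (intro definable_intro)
    show "\<forall>P. ?prod zero P \<longrightarrow> fin P"
    proof (intro allI impI)
      fix P assume "?prod zero P"
      then have "P = zero" by (simp add: ext_iff)
      then show "fin P" by simp
    qed
  next
    fix A x assume IH: "\<forall>P. ?prod A P \<longrightarrow> fin P"
    show "\<forall>P. ?prod (adjoin x A) P \<longrightarrow> fin P"
    proof (intro allI impI)
      fix P assume P: "?prod (adjoin x A) P"
      obtain Q where Q: "?prod A Q" using product_exists by blast
      obtain S where S: "elts S = {p. \<exists>a b. a \<in> elts (adjoin x zero) \<and> b \<in> elts B \<and> p = opair a b}"
        using product_exists by blast
      have d: "definable (\<lambda>e. e (Suc 0) = opair x (e 0))" by (intro definable_intro)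
      have "equipotent B S"
        by (rule equipotentI[of "\<lambda>b p. p = opair x b" B "opair x", OF d])
          (auto simp: bij_betw_def inj_on_def opair_eq_iff S)
      then have "fin S" using assms(2) equipotent_sym equipotent_trans unfolding fin_def by blast
      moreover have "elts P = elts Q \<union> elts S" unfolding P Q S by auto
      ultimately show "fin P" using fin_union[of Q S P] IH Q by blast
    qed
  qed
  then show ?thesis using assms(3) by blast
qed

definition nmax :: "'a \<Rightarrow> 'a \<Rightarrow> 'a" where "nmax a b = (if a \<in> elts b then b else a)"

lemma elts_nmax:
  assumes "a \<in> elts omega" "b \<in> elts omega"
  shows "elts (nmax a b) = {x. x \<in> elts a \<or> x \<in> elts b}"
  using assms nat_subset nat_linear[of a b] unfolding nmax_def by auto

lemma le_nmax:
  assumes "a \<in> elts omega" "b \<in> elts omega"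
  shows "a \<in> elts (succ (nmax a b))" "b \<in> elts (succ (nmax a b))"
  using assms nat_linear[of a b] unfolding nmax_def by auto

lemma nmax_omega: "a \<in> elts omega \<Longrightarrow> b \<in> elts omega \<Longrightarrow> nmax a b \<in> elts omega"
  unfolding nmax_def by auto

text \<open>
  Pairs of natural numbers are ordered by their maximum, then lexicographically.  The initial
  segment of a pair with maximum \<open>m\<close> lies in the square of \<open>succ m\<close>, so it is finite.
\<close>

lemma omega_pairing_exists:
  obtains P h where "elts P = {p. \<exists>a b. a \<in> elts omega \<and> b \<in> elts omega \<and> p = opair a b}"
    "fun_on h P" "\<And>p. p \<in> elts P \<Longrightarrow> app h p \<in> elts omega" "inj_on (app h) (elts P)"
proof -
  obtain P where P: "elts P = {p. \<exists>a b. a \<in> elts omega \<and> b \<in> elts omega \<and> p = opair a b}"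
    using product_exists by blast
  \<comment> \<open>The maximum of two natural numbers is their union as sets, which makes it visibly definable.\<close>
  define L where "L p q \<longleftrightarrow> (\<exists>a b c d s t. p = opair a b \<and> q = opair c d
      \<and> elts s = {x. x \<in> elts a \<or> x \<in> elts b} \<and> elts t = {x. x \<in> elts c \<or> x \<in> elts d}
      \<and> (s \<in> elts t \<or> s = t \<and> (a \<in> elts c \<or> a = c \<and> b \<in> elts d)))" for p q
  have d: "definable (\<lambda>e. L (e 0) (e (Suc 0)))" unfolding L_def by (intro definable_intro)
  have L: "L (opair a b) (opair c d) \<longleftrightarrow> nmax a b \<in> elts (nmax c d)
      \<or> nmax a b = nmax c d \<and> (a \<in> elts c \<or> a = c \<and> b \<in> elts d)"
    if "a \<in> elts omega" "b \<in> elts omega" "c \<in> elts omega" "d \<in> elts omega" for a b c d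
  proof -
    have s: "elts s = {x. x \<in> elts a \<or> x \<in> elts b} \<longleftrightarrow> s = nmax a b"
      "elts s = {x. x \<in> elts c \<or> x \<in> elts d} \<longleftrightarrow> s = nmax c d" for s
      using elts_nmax that by (simp_all add: ext_iff)
    show ?thesis by (simp add: L_def opair_eq_iff s)
  qed
  have "\<exists>h. fun_on h P \<and> (\<forall>x\<in>elts P. app h x \<in> elts omega) \<and> inj_on (app h) (elts P)
    \<and> (\<forall>x\<in>elts P. \<forall>z. elts z = {y \<in> elts P. L y x} \<longrightarrow> app h x = card_of z)"
  proof (rule rank_injection[of L, OF d])
    fix x z assume "x \<in> elts P" and z: "elts z = {y \<in> elts P. L y x}"
    then obtain c d where x: "x = opair c d" "c \<in> elts omega" "d \<in> elts omega" unfolding P by blast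
    let ?m = "succ (nmax c d)"
    obtain Q where Q: "elts Q = {p. \<exists>a b. a \<in> elts ?m \<and> b \<in> elts ?m \<and> p = opair a b}"
      using product_exists by blast
    have "fin Q" using fin_product[OF _ _ Q] fin_nat nmax_omega succ_omega x by blast
    moreover have "elts z \<subseteq> elts Q"
    proof
      fix y assume "y \<in> elts z"
      then obtain a b where y: "y = opair a b" "a \<in> elts omega" "b \<in> elts omega" "L y x"
        unfolding z P by blast
      then have "nmax a b \<in> elts (nmax c d) \<or> nmax a b = nmax c d" using L x by blast
      then have "elts (succ (nmax a b)) \<subseteq> elts ?m"
        using nat_subset[OF nmax_omega[OF x(2,3)]] by auto
      then show "y \<in> elts Q" unfolding Q using le_nmax[OF y(2,3)] y(1) by blast
    qed
    ultimately show "fin z" by (rule fin_subset)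
  next
    fix x assume "x \<in> elts P"
    then show "\<not> L x x" unfolding P using L not_mem_self by blast
  next
    fix x y z assume xyz: "x \<in> elts P" "y \<in> elts P" "z \<in> elts P" "L x y" "L y z"
    obtain a b where x: "x = opair a b" "a \<in> elts omega" "b \<in> elts omega" using xyz P by blast
    obtain c d where y: "y = opair c d" "c \<in> elts omega" "d \<in> elts omega" using xyz P by blast
    obtain f g where z: "z = opair f g" "f \<in> elts omega" "g \<in> elts omega" using xyz P by blast
    have "nmax a b \<in> elts (nmax c d) \<longrightarrow> nmax c d \<in> elts (nmax f g) \<longrightarrow> nmax a b \<in> elts (nmax f g)"
      "a \<in> elts c \<longrightarrow> c \<in> elts f \<longrightarrow> a \<in> elts f" "b \<in> elts d \<longrightarrow> d \<in> elts g \<longrightarrow> b \<in> elts g"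
      using nat_mem_trans nmax_omega z(2,3) by blast+
    then show "L x z"
      using xyz(4,5) unfolding x(1) y(1) z(1) L[OF x(2,3) y(2,3)] L[OF y(2,3) z(2,3)]
        L[OF x(2,3) z(2,3)] by auto
  next
    fix x y assume xy: "x \<in> elts P" "y \<in> elts P"
    obtain a b where x: "x = opair a b" "a \<in> elts omega" "b \<in> elts omega" using xy P by blast
    obtain c d where y: "y = opair c d" "c \<in> elts omega" "d \<in> elts omega" using xy P by blast
    show "x = y \<or> L x y \<or> L y x"
      using nat_linear[OF nmax_omega[OF x(2,3)] nmax_omega[OF y(2,3)]] nat_linear[OF x(2) y(2)]
        nat_linear[OF x(3) y(3)]
      unfolding x(1) y(1) L[OF x(2,3) y(2,3)] L[OF y(2,3) x(2,3)] opair_eq_iff by auto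
  qed
  then show ?thesis using that P by blast
qed

text \<open>
  A countable union of countable sets is countable when the enumerations are given uniformly, here by
  the relation \<open>R\<close> and a single countable set \<open>B\<close> of second indices.
\<close>

lemma ctblI_double_surjection:
  assumes R: "definable (\<lambda>e. R (e 0) (e (Suc 0)) (e (Suc (Suc 0))))" and B: "ctbl B"
    and ex: "\<And>y. y \<in> elts W \<Longrightarrow> \<exists>n\<in>elts omega. \<exists>V\<in>elts B. R n V y"
    and un: "\<And>n V y y'. n \<in> elts omega \<Longrightarrow> V \<in> elts B \<Longrightarrow> R n V y \<Longrightarrow> R n V y' \<Longrightarrow> y = y'"
  shows "ctbl W"
proof -
  obtain P h where P: "elts P = {p. \<exists>a b. a \<in> elts omega \<and> b \<in> elts omega \<and> p = opair a b}"
    and h: "fun_on h P" "\<And>p. p \<in> elts P \<Longrightarrow> app h p \<in> elts omega" "inj_on (app h) (elts P)"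
    using omega_pairing_exists by blast
  obtain j where j: "fun_on j B" "\<And>x. x \<in> elts B \<Longrightarrow> app j x \<in> elts omega" "inj_on (app j) (elts B)"
    using ctbl_injection[OF B] by blast
  have d: "definable (\<lambda>e. \<exists>n m V. n \<in> elts omega \<and> opair V m \<in> elts j
      \<and> opair (opair n m) (e 0) \<in> elts h \<and> R n V (e (Suc 0)))"
    by (intro definable_intro definable_subst3[OF R])
  show ?thesis
  proof (rule ctblI_surjection[OF d])
    fix y assume "y \<in> elts W"
    then obtain n V where nV: "n \<in> elts omega" "V \<in> elts B" "R n V y" using ex by blast
    let ?p = "opair n (app j V)"
    have "?p \<in> elts P" unfolding P using nV j(2) by blast
    then have "app h ?p \<in> elts omega" "opair ?p (app h ?p) \<in> elts h" using h app_eq by blast+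
    moreover have "opair V (app j V) \<in> elts j" using app_eq[OF j(1) nV(2)] by blast
    ultimately show "\<exists>k\<in>elts omega. \<exists>n m V. n \<in> elts omega \<and> opair V m \<in> elts j
      \<and> opair (opair n m) k \<in> elts h \<and> R n V y" using nV by blast
  next
    fix k y y'
    assume "\<exists>n m V. n \<in> elts omega \<and> opair V m \<in> elts j \<and> opair (opair n m) k \<in> elts h \<and> R n V y"
    then obtain n m V where 1: "n \<in> elts omega" "opair V m \<in> elts j"
      "opair (opair n m) k \<in> elts h" "R n V y" by blast
    assume "\<exists>n m V. n \<in> elts omega \<and> opair V m \<in> elts j \<and> opair (opair n m) k \<in> elts h \<and> R n V y'"
    then obtain n' m' V' where 2: "n' \<in> elts omega" "opair V' m' \<in> elts j"
      "opair (opair n' m') k \<in> elts h" "R n' V' y'" by blast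
    have "opair n m = opair n' m'"
      using app_eqI[OF h(1) 1(3)] app_eqI[OF h(1) 2(3)] h(3) by (metis inj_onD)
    then have nm: "n = n'" "m = m'" by (simp_all add: opair_eq_iff)
    then have "V = V'" "V \<in> elts B"
      using app_eqI[OF j(1) 1(2)] app_eqI[OF j(1) 2(2)] j(3) by (metis inj_onD)+
    then show "y = y'" using un[of n V] 1 2 nm by blast
  qed
qed

section \<open>Well-orderable sets\<close>

lemma ctbl_well_orderable:
  assumes "ctbl A" shows "well_orderable A"
proof -
  obtain j where j: "fun_on j A" "\<And>x. x \<in> elts A \<Longrightarrow> app j x \<in> elts omega" "inj_on (app j) (elts A)"
    using ctbl_injection[OF assms] by blast
  obtain P where P: "elts P = {p. \<exists>a b. a \<in> elts A \<and> b \<in> elts A \<and> p = opair a b}"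
    using product_exists by blast
  let ?Q = "\<lambda>p. \<exists>x y i k. p = opair x y \<and> opair x i \<in> elts j \<and> opair y k \<in> elts j
      \<and> (i = k \<or> i \<in> elts k)"
  have "definable (\<lambda>e. ?Q (e 0))" by (intro definable_intro)
  from Separation[of ?Q, OF this] obtain r where r: "elts r = {p \<in> elts P. ?Q p}" by blast
  have r: "opair x y \<in> elts r \<longleftrightarrow> app j x = app j y \<or> app j x \<in> elts (app j y)"
    if "x \<in> elts A" "y \<in> elts A" for x y
    using that unfolding r P by (auto simp: opair_eq_iff app_eq[OF j(1), symmetric])
  have least: "\<exists>m\<in>elts S. \<forall>x\<in>elts S. opair m x \<in> elts r"
    if S: "elts S \<subseteq> elts A" "elts S \<noteq> {}" for S
  proof -
    obtain x where x: "x \<in> elts S" using S by blast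
    have o: "opair x k \<in> elts j \<longleftrightarrow> app j x = k" if "x \<in> elts S" for x k
      using app_eq[OF j(1)] S that by blast
    have "definable (\<lambda>e. \<exists>x\<in>elts S. opair x (e 0) \<in> elts j)" by (intro definable_intro)
    from nat_least[of "\<lambda>k. \<exists>x\<in>elts S. opair x k \<in> elts j", OF this, of "app j x"]
    obtain k where k: "\<exists>x\<in>elts S. opair x k \<in> elts j"
      "\<forall>l\<in>elts omega. (\<exists>x\<in>elts S. opair x l \<in> elts j) \<longrightarrow> k = l \<or> k \<in> elts l"
      using o[OF x] j(2)[of x] x S by blast
    then obtain m where "m \<in> elts S" "app j m = k" using o by blast
    moreover have "k = app j y \<or> k \<in> elts (app j y)" if "y \<in> elts S" for y
      using bspec[OF k(2), of "app j y"] o that j(2) S by blast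
    ultimately show ?thesis using r S(1) by blast
  qed
  have "well_orders r A"
    unfolding well_orders_def
  proof (intro conjI ballI allI impI)
    show "x = y" if "x \<in> elts A" "y \<in> elts A" "opair x y \<in> elts r \<and> opair y x \<in> elts r" for x y
      using that r mem_asym j(3) by (metis inj_onD)
    show "opair x z \<in> elts r" if "x \<in> elts A" "y \<in> elts A" "z \<in> elts A"
      "opair x y \<in> elts r \<and> opair y z \<in> elts r" for x y z
      using that r nat_mem_trans[of "app j x" "app j y" "app j z"] j(2) by metis
    show "opair x y \<in> elts r \<or> opair y x \<in> elts r" if "x \<in> elts A" "y \<in> elts A" for x y
      using that r nat_linear[of "app j x" "app j y"] j(2) by metis
  qed (use r least in auto)
  then show ?thesis unfolding well_orderable_def by blast
qed

end

section \<open>Closures\<close>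

locale zf_space = zf_model +
  fixes X T :: 'a
  assumes top: "top_space X T"
begin

lemma open_subset: "U \<in> elts T \<Longrightarrow> elts U \<subseteq> elts X"
  using top unfolding top_space_def by blast

lemma open_space: "X \<in> elts T"
  using top unfolding top_space_def by blast

lemma open_inter: "U \<in> elts T \<Longrightarrow> V \<in> elts T \<Longrightarrow> \<exists>W\<in>elts T. elts W = elts U \<inter> elts V"
  using top unfolding top_space_def by blast

lemma open_union: "elts S \<subseteq> elts T \<Longrightarrow> \<exists>W\<in>elts T. elts W = (\<Union>U\<in>elts S. elts U)"
  using top unfolding top_space_def by blast

lemma closed_inI:
  assumes "elts C \<subseteq> elts X"
    and U: "\<And>x. x \<in> elts X \<Longrightarrow> x \<notin> elts C \<Longrightarrow> \<exists>U\<in>elts T. x \<in> elts U \<and> elts U \<inter> elts C = {}"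
  shows "closed_in X T C"
proof -
  \<comment> \<open>The complement of \<open>C\<close> is the union of all open sets disjoint from \<open>C\<close>.\<close>
  have "definable (\<lambda>e. \<forall>y\<in>elts (e 0). y \<notin> elts C)" by (intro definable_intro)
  from Separation[of "\<lambda>U. \<forall>y\<in>elts U. y \<notin> elts C", OF this, of T]
  obtain S where S: "elts S = {U \<in> elts T. \<forall>y\<in>elts U. y \<notin> elts C}" by blast
  then obtain W where W: "W \<in> elts T" "elts W = (\<Union>U\<in>elts S. elts U)"
    using open_union[of S] by blast
  have "elts W = elts X - elts C"
  proof
    show "elts W \<subseteq> elts X - elts C" unfolding W(2) S using open_subset by blast
    show "elts X - elts C \<subseteq> elts W"
    proof
      fix x assume "x \<in> elts X - elts C"
      then obtain U where "U \<in> elts T" "x \<in> elts U" "elts U \<inter> elts C = {}" using U by blast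
      then show "x \<in> elts W" unfolding W S by blast
    qed
  qed
  then show ?thesis using assms(1) W(1) unfolding closed_in_def by blast
qed

lemma closed_in_subset: "closed_in X T C \<Longrightarrow> elts C \<subseteq> elts X"
  by (simp add: closed_in_def)

lemma closed_in_separate:
  assumes "closed_in X T C" "x \<in> elts X" "x \<notin> elts C"
  shows "\<exists>U\<in>elts T. x \<in> elts U \<and> elts U \<inter> elts C = {}"
  using assms unfolding closed_in_def by blast

text \<open>
  For subsets of the space this set is the closure (lemma \<open>closure_class_eq_cl\<close>).  The description
  by neighbourhoods quantifies only over \<open>T\<close>, so the operation is definable from \<open>X\<close> and \<open>T\<close>.
\<close>

definition cl :: "'a \<Rightarrow> 'a" where
  "cl E = (THE z. elts z = {y. y \<in> elts X \<and> (\<forall>U\<in>elts T. y \<in> elts U \<longrightarrow> (\<exists>v\<in>elts U. v \<in> elts E))})"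

lemma elts_cl:
  "elts (cl E) = {y. y \<in> elts X \<and> (\<forall>U\<in>elts T. y \<in> elts U \<longrightarrow> (\<exists>v\<in>elts U. v \<in> elts E))}"
proof -
  let ?P = "\<lambda>y. \<forall>U\<in>elts T. y \<in> elts U \<longrightarrow> (\<exists>v\<in>elts U. v \<in> elts E)"
  have "definable (\<lambda>e. ?P (e 0))" by (intro definable_intro)
  from Separation[of ?P, OF this, of X]
  obtain z where z: "elts z = {y. y \<in> elts X \<and> ?P y}" by blast
  show ?thesis unfolding cl_def
    by (rule theI[of "\<lambda>z. elts z = {y. y \<in> elts X \<and> ?P y}", OF z]) (simp add: ext_iff z)
qed

lemma definable_cl [definable_intro]:
  assumes "definable_term t" shows "definable_term (\<lambda>e. cl (t e))"
proof -
  have "z = cl E \<longleftrightarrow> elts z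
      = {y. y \<in> elts X \<and> (\<forall>U\<in>elts T. y \<in> elts U \<longrightarrow> (\<exists>v\<in>elts U. v \<in> elts E))}" for z E
    using elts_cl ext_iff by metis
  then have "definable (\<lambda>e. e 0 = cl (e (Suc 0)))" by (simp only:) (intro definable_intro)
  from definable_subst2[of "\<lambda>z E. z = cl E", OF this definable_var definable_term_shift[OF assms]]
  show ?thesis unfolding definable_term_def .
qed

lemma closed_in_cl: "closed_in X T (cl E)"
proof (rule closed_inI)
  fix x assume "x \<in> elts X" "x \<notin> elts (cl E)"
  then obtain U where U: "U \<in> elts T" "x \<in> elts U" "\<forall>v\<in>elts U. v \<notin> elts E"
    unfolding elts_cl by blast
  then have "elts U \<inter> elts (cl E) = {}" unfolding elts_cl by blast
  then show "\<exists>U\<in>elts T. x \<in> elts U \<and> elts U \<inter> elts (cl E) = {}" using U by blast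
qed (auto simp: elts_cl)

lemma subset_cl: "elts E \<subseteq> elts X \<Longrightarrow> elts E \<subseteq> elts (cl E)"
  unfolding elts_cl by blast

lemma cl_minimal:
  assumes "closed_in X T C" "elts E \<subseteq> elts C" shows "elts (cl E) \<subseteq> elts C"
proof
  fix x assume x: "x \<in> elts (cl E)"
  show "x \<in> elts C"
  proof (rule ccontr)
    assume "x \<notin> elts C"
    moreover have "x \<in> elts X" using x by (simp add: elts_cl)
    ultimately obtain U where "U \<in> elts T" "x \<in> elts U" "elts U \<inter> elts C = {}"
      using closed_in_separate[OF assms(1)] by blast
    then show False using x assms(2) unfolding elts_cl by blast
  qed
qed

lemma cl_mono: "elts E \<subseteq> elts F \<Longrightarrow> elts (cl E) \<subseteq> elts (cl F)"
  unfolding elts_cl by blast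

lemma closure_class_eq_cl:
  assumes "elts D \<subseteq> elts X" shows "closure_class X T D = elts (cl D)"
proof
  show "closure_class X T D \<subseteq> elts (cl D)"
    using closed_in_cl subset_cl[OF assms] unfolding closure_class_def by blast
  show "elts (cl D) \<subseteq> closure_class X T D"
  proof
    fix x assume x: "x \<in> elts (cl D)"
    moreover have "x \<in> elts X" using x by (simp add: elts_cl)
    ultimately show "x \<in> closure_class X T D" using cl_minimal unfolding closure_class_def by blast
  qed
qed

lemma regular_shrink:
  assumes "regular X T" "U \<in> elts T" "x \<in> elts U"
  shows "\<exists>V\<in>elts T. x \<in> elts V \<and> elts (cl V) \<subseteq> elts U"
proof -
  have "definable (\<lambda>e. e 0 \<notin> elts U)" by (intro definable_intro)
  from Separation[of "\<lambda>y. y \<notin> elts U", OF this, of X]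
  obtain C where C: "elts C = {y \<in> elts X. y \<notin> elts U}" by blast
  have "elts U = elts X - elts C" using C open_subset[OF assms(2)] by blast
  then have "closed_in X T C" using C assms(2) unfolding closed_in_def by blast
  moreover have "x \<in> elts X - elts C" using assms C open_subset by blast
  ultimately obtain V V' where V: "V \<in> elts T" "V' \<in> elts T" "x \<in> elts V" "elts C \<subseteq> elts V'"
    "elts V \<inter> elts V' = {}" using assms(1) unfolding regular_def by blast
  have "elts (cl V) \<subseteq> elts U"
  proof
    fix y assume y: "y \<in> elts (cl V)"
    then have "y \<notin> elts V'" using V unfolding elts_cl by blast
    moreover have "y \<in> elts X" using y by (simp add: elts_cl)
    ultimately show "y \<in> elts U" using V(4) C by blast
  qed
  then show ?thesis using V by blast
qed

text \<open>
  In the empty space there is no non-empty closed set, and the empty function serves.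
\<close>

lemma loeb_choice:
  assumes "loeb X T"
  shows "\<exists>K f. fun_on f K
    \<and> (\<forall>C. closed_in X T C \<and> elts C \<noteq> {} \<longrightarrow> C \<in> elts K \<and> app f C \<in> elts C)"
proof (cases "elts X = {}")
  case True
  have "fun_on zero zero" by (simp add: fun_on_def)
  moreover have "elts C = {}" if "closed_in X T C" for C using closed_in_subset[OF that] True by simp
  ultimately show ?thesis by blast
next
  case False
  then obtain K f where "elts K = {C. closed_in X T C \<and> elts C \<noteq> {}}" "fun_on f K"
    "\<forall>C\<in>elts K. app f C \<in> elts C" using assms unfolding loeb_def by blast
  then show ?thesis by (intro exI[of _ K] exI[of _ f]) simp
qed

section \<open>Convergent sequences\<close>

lemma seq_closed_inter:
  assumes A: "seq_closed X T A" and C: "closed_in X T C" and D: "elts D = elts A \<inter> elts C"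
  shows "seq_closed X T D"
  unfolding seq_closed_def
proof (intro conjI allI impI)
  show "elts D \<subseteq> elts X" using A D unfolding seq_closed_def by blast
  fix s x assume s: "seq_in D s \<and> converges X T s x"
  then have "seq_in A s" using D unfolding seq_in_def by blast
  then have "x \<in> elts A" using A s unfolding seq_closed_def by blast
  moreover have "x \<in> elts C"
  proof (rule ccontr)
    assume "x \<notin> elts C"
    moreover have "x \<in> elts X" using s unfolding converges_def by blast
    ultimately obtain U where U: "U \<in> elts T" "x \<in> elts U" "elts U \<inter> elts C = {}"
      using closed_in_separate[OF C] by blast
    then obtain m where "m \<in> elts omega" "app s m \<in> elts U" using s unfolding converges_def by blast
    then show False using U s D unfolding seq_in_def by blast
  qed
  ultimately show "x \<in> elts D" using D by blast
qed

text \<open>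
  With a countable base at \<open>x\<close> coded injectively by natural numbers, the \<open>n\<close>-th set is the
  intersection of the members of the base with code below \<open>n\<close>.  It is open by induction on \<open>n\<close>: at most
  one member has code \<open>n\<close>.
\<close>

lemma decreasing_base:
  assumes "first_countable X T" "x \<in> elts X"
  shows "\<exists>w. fun_on w omega \<and> (\<forall>n\<in>elts omega. app w n \<in> elts T \<and> x \<in> elts (app w n))
    \<and> (\<forall>n\<in>elts omega. \<forall>m\<in>elts n. elts (app w n) \<subseteq> elts (app w m))
    \<and> (\<forall>U\<in>elts T. x \<in> elts U \<longrightarrow> (\<exists>n\<in>elts omega. elts (app w n) \<subseteq> elts U))"
proof -
  obtain B where B: "ctbl B" "elts B \<subseteq> elts T" "\<forall>V\<in>elts B. x \<in> elts V"
    "\<forall>U\<in>elts T. x \<in> elts U \<longrightarrow> (\<exists>V\<in>elts B. elts V \<subseteq> elts U)"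
    using assms unfolding first_countable_def by blast
  obtain j where j: "fun_on j B" "\<And>V. V \<in> elts B \<Longrightarrow> app j V \<in> elts omega" "inj_on (app j) (elts B)"
    using ctbl_injection[OF B(1)] by blast
  let ?R = "\<lambda>n y. \<forall>V\<in>elts B. \<forall>k. opair V k \<in> elts j \<longrightarrow> k \<in> elts n \<longrightarrow> y \<in> elts V"
  have d: "definable (\<lambda>e. ?R (e 0) (e (Suc 0)))" by (intro definable_intro)
  obtain w where w: "fun_on w omega"
    "\<And>n. n \<in> elts omega \<Longrightarrow> elts (app w n) = {y \<in> elts X. ?R n y}"
    using family_exists[of ?R, OF d, of omega X] by blast
  have R: "?R n y \<longleftrightarrow> (\<forall>V\<in>elts B. app j V \<in> elts n \<longrightarrow> y \<in> elts V)" for n y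
    by (auto simp: app_eq[OF j(1), symmetric])
  have "app w n \<in> elts T" if n: "n \<in> elts omega" for n
  proof -
    have "\<exists>W\<in>elts T. elts W = {y. y \<in> elts X \<and> ?R n y}"
    proof (rule omega_induct[of n "\<lambda>n. \<exists>W\<in>elts T. elts W = {y. y \<in> elts X \<and> ?R n y}", OF n])
      show "definable (\<lambda>e. \<exists>W\<in>elts T. elts W = {y. y \<in> elts X \<and> ?R (e 0) y})"
        by (intro definable_intro)
      show "\<exists>W\<in>elts T. elts W = {y. y \<in> elts X \<and> ?R zero y}"
        using open_space by (intro bexI[of _ X]) auto
    next
      fix n assume "\<exists>W\<in>elts T. elts W = {y. y \<in> elts X \<and> ?R n y}"
      then obtain W where W: "W \<in> elts T" "elts W = {y. y \<in> elts X \<and> ?R n y}" by blast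
      show "\<exists>W\<in>elts T. elts W = {y. y \<in> elts X \<and> ?R (succ n) y}"
      proof (cases "\<exists>V\<in>elts B. app j V = n")
        case True
        then obtain V where V: "V \<in> elts B" "app j V = n" by blast
        have un: "\<forall>V'\<in>elts B. app j V' = n \<longrightarrow> V' = V"
          using j(3) V unfolding inj_on_def by metis
        obtain W' where W': "W' \<in> elts T" "elts W' = elts W \<inter> elts V"
          using open_inter W(1) V(1) B(2) by blast
        have R': "?R (succ n) y \<longleftrightarrow> ?R n y \<and> y \<in> elts V" for y
          unfolding R unfolding elts_adjoin using V un by blast
        have "elts W' = {y. y \<in> elts X \<and> ?R (succ n) y}" unfolding W'(2) W(2) R' by blast
        then show ?thesis using W'(1) by blast
      next
        case False
        then have R': "?R (succ n) y \<longleftrightarrow> ?R n y" for y unfolding R unfolding elts_adjoin by blast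
        show ?thesis unfolding R' using W by blast
      qed
    qed
    then obtain W where "W \<in> elts T" "elts W = elts (app w n)" using w(2)[OF n] by auto
    then show ?thesis using extensionality by metis
  qed
  moreover have "x \<in> elts (app w n)" if "n \<in> elts omega" for n
    using w(2)[OF that] B(3) assms(2) by simp
  moreover have "elts (app w n) \<subseteq> elts (app w m)" if "n \<in> elts omega" "m \<in> elts n" for n m
  proof -
    have "m \<in> elts omega" "elts m \<subseteq> elts n" using that omega_transitive nat_subset by blast+
    then show ?thesis using w(2)[of m] w(2)[OF that(1)] by auto
  qed
  moreover have "\<exists>n\<in>elts omega. elts (app w n) \<subseteq> elts U" if U: "U \<in> elts T" "x \<in> elts U" for U
  proof -
    obtain V where V: "V \<in> elts B" "elts V \<subseteq> elts U" using B(4) U by blast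
    have n: "succ (app j V) \<in> elts omega" using j(2)[OF V(1)] by simp
    have "elts (app w (succ (app j V))) \<subseteq> elts V"
      unfolding w(2)[OF n] R using V(1) by auto
    then show ?thesis using n V(2) by blast
  qed
  ultimately show ?thesis using w(1) by blast
qed

text \<open>
  The least elements, for one well-order of \<open>E\<close>, of the traces on \<open>E\<close> of a decreasing base at \<open>c\<close>
  form a sequence in \<open>E\<close> that converges to \<open>c\<close>.
\<close>

lemma well_orderable_cl_subset:
  assumes fc: "first_countable X T" and A: "seq_closed X T A"
    and E: "elts E \<subseteq> elts A" "well_orderable E" and c: "c \<in> elts (cl E)"
  shows "c \<in> elts A"
proof -
  have cX: "c \<in> elts X" using c by (simp add: elts_cl)
  obtain w where w: "fun_on w omega" "\<forall>n\<in>elts omega. app w n \<in> elts T \<and> c \<in> elts (app w n)"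
    "\<forall>n\<in>elts omega. \<forall>m\<in>elts n. elts (app w n) \<subseteq> elts (app w m)"
    "\<forall>U\<in>elts T. c \<in> elts U \<longrightarrow> (\<exists>n\<in>elts omega. elts (app w n) \<subseteq> elts U)"
    using decreasing_base[OF fc cX] by blast
  obtain r where r: "well_orders r E" using E(2) unfolding well_orderable_def by blast
  let ?R = "\<lambda>n y. y \<in> elts E \<and> (\<exists>W. opair n W \<in> elts w \<and> y \<in> elts W
      \<and> (\<forall>z\<in>elts E. z \<in> elts W \<longrightarrow> opair y z \<in> elts r))"
  have d: "definable (\<lambda>e. ?R (e 0) (e (Suc 0)))" by (intro definable_intro)
  have R: "?R n y \<longleftrightarrow> y \<in> elts E \<and> y \<in> elts (app w n)
      \<and> (\<forall>z\<in>elts E. z \<in> elts (app w n) \<longrightarrow> opair y z \<in> elts r)" if "n \<in> elts omega" for n y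
    using that by (simp add: app_eq[OF w(1), symmetric])
  have ex: "\<exists>y. ?R n y" if n: "n \<in> elts omega" for n
  proof -
    have "definable (\<lambda>e. e 0 \<in> elts (app w n))" by (intro definable_intro)
    from Separation[of "\<lambda>z. z \<in> elts (app w n)", OF this, of E]
    obtain S where S: "elts S = {z \<in> elts E. z \<in> elts (app w n)}" by blast
    have "elts S \<noteq> {}" using c w(2) n unfolding S elts_cl by blast
    moreover have "elts S \<subseteq> elts E" using S by blast
    ultimately obtain m where "m \<in> elts S" "\<forall>x\<in>elts S. opair m x \<in> elts r"
      using r unfolding well_orders_def by blast
    then show ?thesis unfolding R[OF n] using S by blast
  qed
  define F where "F n = (SOME y. ?R n y)" for n
  have F: "?R n (F n)" if "n \<in> elts omega" for n unfolding F_def using ex[OF that] by (rule someI_ex)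
  have antisym: "x = y" if "x \<in> elts E" "y \<in> elts E" "opair x y \<in> elts r" "opair y x \<in> elts r" for x y
    using r that unfolding well_orders_def by blast
  have iff: "?R n y \<longleftrightarrow> F n = y" if n: "n \<in> elts omega" for n y
  proof
    assume y: "?R n y"
    then show "F n = y" using F[OF n] unfolding R[OF n] by (intro antisym) auto
  qed (use F[OF n] in blast)
  obtain s where s: "fun_on s omega" "\<And>n. n \<in> elts omega \<Longrightarrow> app s n = F n"
    using function_exists[of ?R, OF d iff] by blast
  have sE: "app s n \<in> elts E" "app s n \<in> elts (app w n)" if "n \<in> elts omega" for n
    using F[OF that] s(2)[OF that] unfolding R[OF that] by simp_all
  have "seq_in A s" using s(1) sE(1) E(1) unfolding seq_in_def by blast
  moreover have "converges X T s c"
    unfolding converges_def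
  proof (intro conjI cX ballI impI)
    fix U assume "U \<in> elts T" "c \<in> elts U"
    then obtain m where m: "m \<in> elts omega" "elts (app w m) \<subseteq> elts U" using w(4) by blast
    have "app s n \<in> elts U" if "n \<in> elts omega" "m = n \<or> m \<in> elts n" for n
    proof -
      have "elts (app w n) \<subseteq> elts (app w m)" using w(3) that by blast
      then show ?thesis using sE(2)[OF that(1)] m(2) by blast
    qed
    then show "\<exists>m\<in>elts omega. \<forall>n\<in>elts omega. m = n \<or> m \<in> elts n \<longrightarrow> app s n \<in> elts U"
      using m(1) by blast
  qed
  ultimately show ?thesis using A unfolding seq_closed_def by blast
qed

lemma first_countable_if_second_countable:
  assumes "second_countable X T" shows "first_countable X T"
proof -
  obtain B where B: "ctbl B" "elts B \<subseteq> elts T"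
    "\<forall>U\<in>elts T. \<forall>x\<in>elts U. \<exists>V\<in>elts B. x \<in> elts V \<and> elts V \<subseteq> elts U"
    using assms unfolding second_countable_def by blast
  show ?thesis
    unfolding first_countable_def
  proof
    fix x
    have "definable (\<lambda>e. x \<in> elts (e 0))" by (intro definable_intro)
    from Separation[of "\<lambda>V. x \<in> elts V", OF this, of B]
    obtain C where C: "elts C = {V \<in> elts B. x \<in> elts V}" by blast
    then have "ctbl C" using ctbl_subset[OF B(1), of C] by blast
    moreover have "\<exists>V\<in>elts C. elts V \<subseteq> elts U" if "U \<in> elts T" "x \<in> elts U" for U
      using B(3) that unfolding C by blast
    ultimately show "\<exists>B. ctbl B \<and> elts B \<subseteq> elts T \<and> (\<forall>V\<in>elts B. x \<in> elts V)
        \<and> (\<forall>U\<in>elts T. x \<in> elts U \<longrightarrow> (\<exists>V\<in>elts B. elts V \<subseteq> elts U))"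
      using B(2) C by (intro exI[of _ C]) auto
  qed
qed

section \<open>The equivalences\<close>

lemma sequential_imp_wo_selection:
  assumes L: "loeb X T" and S: "sequential X T" shows "wo_selection X T"
  unfolding wo_selection_def
proof (intro allI impI)
  fix J A assume A: "seq_closed_family X T J A"
  obtain K f where f: "fun_on f K"
    "\<forall>C. closed_in X T C \<and> elts C \<noteq> {} \<longrightarrow> C \<in> elts K \<and> app f C \<in> elts C"
    using loeb_choice[OF L] by blast
  let ?R = "\<lambda>j y. \<exists>C. opair j C \<in> elts A \<and> opair C y \<in> elts f"
  have d: "definable (\<lambda>e. ?R (e 0) (e (Suc 0)))" by (intro definable_intro)
  obtain B where B: "fun_on B J" "\<And>j. j \<in> elts J \<Longrightarrow> elts (app B j) = {y \<in> elts X. ?R j y}"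
    using family_exists[of ?R, OF d, of J X] by blast
  have "elts (app B j) \<noteq> {} \<and> well_orderable (app B j) \<and> elts (app B j) \<subseteq> elts (app A j)"
    if j: "j \<in> elts J" for j
  proof -
    have "fun_on A J" and Aj: "elts (app A j) \<noteq> {}" "seq_closed X T (app A j)"
      using A j unfolding seq_closed_family_def by blast+
    have cl: "closed_in X T (app A j)" using S Aj(2) unfolding sequential_def by blast
    have K: "app A j \<in> elts K" "app f (app A j) \<in> elts (app A j)" using f(2) cl Aj(1) by blast+
    have "?R j y \<longleftrightarrow> app f (app A j) = y" for y
      using app_eq[OF \<open>fun_on A J\<close> j] app_eq[OF f(1) K(1)] by metis
    then have "elts (app B j) = {app f (app A j)}"
      using B(2)[OF j] K(2) closed_in_subset[OF cl] by auto
    moreover from this have "app B j = adjoin (app f (app A j)) zero" by (simp add: ext_iff)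
    then have "well_orderable (app B j)"
      using ctbl_well_orderable fin_adjoin[OF fin_zero] unfolding ctbl_def by metis
    ultimately show ?thesis using K(2) by simp
  qed
  then show "\<exists>B. fun_on B J \<and> (\<forall>j\<in>elts J. elts (app B j) \<noteq> {} \<and> well_orderable (app B j)
      \<and> elts (app B j) \<subseteq> elts (app A j))" using B(1) by blast
qed

lemma wo_selection_imp_partial_wo_selection:
  "wo_selection X T \<Longrightarrow> partial_wo_selection X T"
  unfolding wo_selection_def partial_wo_selection_def using not_fin_omega by blast

text \<open>
  The points \<open>f (cl B\<^sub>n)\<close> are defined only for \<open>n \<in> N\<close>.  Instead of enumerating \<open>N\<close>, the sequence
  takes at \<open>m\<close> the point with index the least \<open>n \<in> N\<close> with \<open>m \<le> n\<close>; this suffices because the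
  base at \<open>x\<close> is decreasing.
\<close>

lemma partial_wo_selection_imp_sequential:
  assumes L: "loeb X T" and reg: "regular X T" and fc: "first_countable X T"
    and P: "partial_wo_selection X T"
  shows "sequential X T"
  unfolding sequential_def
proof (intro allI impI)
  fix A assume A: "seq_closed X T A"
  have AX: "elts A \<subseteq> elts X" using A unfolding seq_closed_def by blast
  obtain K f where f: "fun_on f K"
    "\<forall>C. closed_in X T C \<and> elts C \<noteq> {} \<longrightarrow> C \<in> elts K \<and> app f C \<in> elts C"
    using loeb_choice[OF L] by blast
  have "x \<in> elts A" if x: "x \<in> elts (cl A)" for x
  proof -
    have xX: "x \<in> elts X" using x by (simp add: elts_cl)
    obtain w where w: "fun_on w omega" "\<forall>n\<in>elts omega. app w n \<in> elts T \<and> x \<in> elts (app w n)"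
      "\<forall>n\<in>elts omega. \<forall>m\<in>elts n. elts (app w n) \<subseteq> elts (app w m)"
      "\<forall>U\<in>elts T. x \<in> elts U \<longrightarrow> (\<exists>n\<in>elts omega. elts (app w n) \<subseteq> elts U)"
      using decreasing_base[OF fc xX] by blast
    let ?Q = "\<lambda>n y. \<exists>W. opair n W \<in> elts w \<and> y \<in> elts (cl W)"
    have "definable (\<lambda>e. ?Q (e 0) (e (Suc 0)))" by (intro definable_intro)
    from family_exists[of ?Q, OF this, of omega A]
    obtain AA where AA: "fun_on AA omega"
      "\<And>n. n \<in> elts omega \<Longrightarrow> elts (app AA n) = {y \<in> elts A. ?Q n y}" by blast
    have AA_eq: "elts (app AA n) = elts A \<inter> elts (cl (app w n))" if "n \<in> elts omega" for n
      using AA(2)[OF that] that by (auto simp: app_eq[OF w(1), symmetric])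
    have "seq_closed_family X T omega AA"
      unfolding seq_closed_family_def
    proof (intro conjI ballI AA(1))
      fix n assume n: "n \<in> elts omega"
      show "seq_closed X T (app AA n)" using seq_closed_inter[OF A closed_in_cl AA_eq[OF n]] .
      obtain v where "v \<in> elts (app w n)" "v \<in> elts A" using x w(2) n unfolding elts_cl by blast
      then show "elts (app AA n) \<noteq> {}"
        using AA_eq[OF n] subset_cl[of "app w n"] open_subset[of "app w n"] w(2) n by blast
    qed
    then obtain N B where N: "elts N \<subseteq> elts omega" "\<not> fin N" and B: "fun_on B N"
      "\<forall>n\<in>elts N. elts (app B n) \<noteq> {} \<and> well_orderable (app B n)
         \<and> elts (app B n) \<subseteq> elts (app AA n)"
      using P unfolding partial_wo_selection_def by blast
    have Bcl: "cl (app B n) \<in> elts K" "app f (cl (app B n)) \<in> elts (cl (app B n))"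
      if n: "n \<in> elts N" for n
    proof -
      have "elts (app B n) \<subseteq> elts X" using B(2) n AA_eq N(1) AX by blast
      then have "elts (cl (app B n)) \<noteq> {}" using subset_cl B(2) n by blast
      then show "cl (app B n) \<in> elts K" "app f (cl (app B n)) \<in> elts (cl (app B n))"
        using f(2) closed_in_cl by blast+
    qed
    \<comment> \<open>\<open>?next m n\<close>: the least \<open>n\<close> in \<open>N\<close> that is at least \<open>m\<close>; it exists
      because an infinite set of natural numbers is unbounded.\<close>
    let ?next = "\<lambda>m n. n \<in> elts N \<and> (m = n \<or> m \<in> elts n)
        \<and> (\<forall>k\<in>elts N. m = k \<or> m \<in> elts k \<longrightarrow> n = k \<or> n \<in> elts k)"
    let ?R = "\<lambda>m y. \<exists>n b. ?next m n \<and> opair n b \<in> elts B \<and> opair (cl b) y \<in> elts f"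
    have d: "definable (\<lambda>e. ?R (e 0) (e (Suc 0)))" by (intro definable_intro)
    have next_ex: "\<exists>n. ?next m n" if m: "m \<in> elts omega" for m
    proof -
      have "\<not> elts N \<subseteq> elts m" using N(2) fin_subset fin_nat[OF m] by blast
      then obtain n where "n \<in> elts N" "m = n \<or> m \<in> elts n" using nat_linear[OF m] N(1) by blast
      moreover have "definable (\<lambda>e. e 0 \<in> elts N \<and> (m = e 0 \<or> m \<in> elts (e 0)))"
        by (intro definable_intro)
      ultimately have "\<exists>n\<in>elts omega. (n \<in> elts N \<and> (m = n \<or> m \<in> elts n))
          \<and> (\<forall>k\<in>elts omega. k \<in> elts N \<and> (m = k \<or> m \<in> elts k) \<longrightarrow> n = k \<or> n \<in> elts k)"
        using N(1) by (intro nat_least[of "\<lambda>n. n \<in> elts N \<and> (m = n \<or> m \<in> elts n)" n]) auto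
      then show ?thesis using N(1) by blast
    qed
    define g where "g m = (SOME n. ?next m n)" for m
    have g: "?next m (g m)" if "m \<in> elts omega" for m
      unfolding g_def using next_ex[OF that] by (rule someI_ex)
    have iff: "?R m y \<longleftrightarrow> app f (cl (app B (g m))) = y" if m: "m \<in> elts omega" for m y
    proof -
      have gN: "g m \<in> elts N" using g[OF m] by blast
      have next_iff: "?next m n \<longleftrightarrow> n = g m" for n
      proof
        assume "?next m n"
        then have "n = g m \<or> n \<in> elts (g m)" "g m = n \<or> g m \<in> elts n" using g[OF m] by blast+
        then show "n = g m" using mem_asym by blast
      next
        assume "n = g m"
        then show "?next m n" using g[OF m] by simp
      qed
      have "?R m y \<longleftrightarrow> (\<exists>b. opair (g m) b \<in> elts B \<and> opair (cl b) y \<in> elts f)"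
        unfolding next_iff by simp
      also have "\<dots> \<longleftrightarrow> opair (cl (app B (g m))) y \<in> elts f"
        using gN by (simp add: app_eq[OF B(1), symmetric])
      also have "\<dots> \<longleftrightarrow> app f (cl (app B (g m))) = y"
        using app_eq[OF f(1) Bcl(1)[OF gN]] by simp
      finally show ?thesis .
    qed
    obtain s where s: "fun_on s omega" "\<And>m. m \<in> elts omega \<Longrightarrow> app s m = app f (cl (app B (g m)))"
      using function_exists[of ?R, OF d iff] by blast
    have sB: "app s m \<in> elts (cl (app B (g m)))" if "m \<in> elts omega" for m
      using Bcl(2) g[OF that] s(2)[OF that] by simp
    have "app s m \<in> elts A" if m: "m \<in> elts omega" for m
    proof -
      have "elts (app B (g m)) \<subseteq> elts A" "well_orderable (app B (g m))"
        using g[OF m] B(2) AA_eq N(1) by blast+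
      then show ?thesis using well_orderable_cl_subset[OF fc A _ _ sB[OF m]] by blast
    qed
    then have "seq_in A s" using s(1) unfolding seq_in_def by blast
    moreover have "converges X T s x"
      unfolding converges_def
    proof (intro conjI xX ballI impI)
      fix U assume "U \<in> elts T" "x \<in> elts U"
      then obtain V where V: "V \<in> elts T" "x \<in> elts V" "elts (cl V) \<subseteq> elts U"
        using regular_shrink[OF reg] by blast
      then obtain k where k: "k \<in> elts omega" "elts (app w k) \<subseteq> elts V" using w(4) by blast
      have "app s m \<in> elts U" if m: "m \<in> elts omega" "k = m \<or> k \<in> elts m" for m
      proof -
        have gm: "g m \<in> elts omega" "g m \<in> elts N" "m = g m \<or> m \<in> elts (g m)"
          using g[OF m(1)] N(1) by blast+
        then have "k = g m \<or> k \<in> elts (g m)" using m(2) nat_mem_trans by metis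
        then have "elts (app w (g m)) \<subseteq> elts V" using w(3) gm(1) k(2) by blast
        then have "elts (cl (app w (g m))) \<subseteq> elts U" using cl_mono V(3) by blast
        moreover have "elts (cl (app B (g m))) \<subseteq> elts (cl (app w (g m)))"
          using cl_minimal[OF closed_in_cl] B(2) gm(2) AA_eq[OF gm(1)] by blast
        ultimately show ?thesis using sB[OF m(1)] by blast
      qed
      then show "\<exists>m\<in>elts omega. \<forall>n\<in>elts omega. m = n \<or> m \<in> elts n \<longrightarrow> app s n \<in> elts U"
        using k(1) by blast
    qed
    ultimately show ?thesis using A unfolding seq_closed_def by blast
  qed
  then have "elts (cl A) = elts A" using subset_cl[OF AX] by blast
  then have "cl A = A" by (rule extensionality)
  then show "closed_in X T A" using closed_in_cl by metis
qed

text \<open>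
  The point \<open>f (cl (V \<inter> A\<^sub>n))\<close> lies in \<open>A\<^sub>n\<close>, which is closed, but perhaps not in \<open>V\<close>.  It is in
  \<open>cl V\<close>, and by regularity every neighbourhood of a point contains the closure of a basic one.
\<close>

lemma sequential_imp_countable_dense_selection:
  assumes L: "loeb X T" and reg: "regular X T" and sc: "second_countable X T"
    and S: "sequential X T"
  shows "countable_dense_selection X T"
  unfolding countable_dense_selection_def
proof (intro allI impI)
  fix A assume A: "seq_closed_family X T omega A"
  obtain K f where f: "fun_on f K"
    "\<forall>C. closed_in X T C \<and> elts C \<noteq> {} \<longrightarrow> C \<in> elts K \<and> app f C \<in> elts C"
    using loeb_choice[OF L] by blast
  obtain B where B: "ctbl B" "elts B \<subseteq> elts T"
    "\<forall>U\<in>elts T. \<forall>x\<in>elts U. \<exists>V\<in>elts B. x \<in> elts V \<and> elts V \<subseteq> elts U"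
    using sc unfolding second_countable_def by blast
  have An: "closed_in X T (app A n)"
    if "n \<in> elts omega" for n
    using A S that unfolding seq_closed_family_def sequential_def by blast
  have fA: "fun_on A omega" using A unfolding seq_closed_family_def by blast
  let ?R = "\<lambda>n V y. \<exists>C E v. opair n C \<in> elts A \<and> elts E = {v. v \<in> elts V \<and> v \<in> elts C}
      \<and> v \<in> elts E \<and> opair (cl E) y \<in> elts f"
  have dR: "definable (\<lambda>e. ?R (e 0) (e (Suc 0)) (e (Suc (Suc 0))))" by (intro definable_intro)
  let ?D = "\<lambda>n y. \<exists>V\<in>elts B. ?R n V y"
  have dD: "definable (\<lambda>e. ?D (e 0) (e (Suc 0)))" by (intro definable_intro)
  obtain D where D: "fun_on D omega"
    "\<And>n. n \<in> elts omega \<Longrightarrow> elts (app D n) = {y \<in> elts X. ?D n y}"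
    using family_exists[of ?D, OF dD, of omega X] by blast
  have point: "app f (cl E) \<in> elts (cl E)" "opair (cl E) y \<in> elts f \<longleftrightarrow> app f (cl E) = y"
    if "v \<in> elts E" "elts E \<subseteq> elts X" for E v y
  proof -
    have "elts (cl E) \<noteq> {}" using subset_cl that by blast
    then have "cl E \<in> elts K" "app f (cl E) \<in> elts (cl E)" using f(2) closed_in_cl by blast+
    then show "app f (cl E) \<in> elts (cl E)" "opair (cl E) y \<in> elts f \<longleftrightarrow> app f (cl E) = y"
      using app_eq[OF f(1)] by simp_all
  qed
  define E where "E n V = (THE z. elts z = {v \<in> elts V. v \<in> elts (app A n)})" for n V
  have E: "elts (E n V) = {v \<in> elts V. v \<in> elts (app A n)}" for n V
  proof -
    have "definable (\<lambda>e. e 0 \<in> elts (app A n))" by (intro definable_intro)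
    from Separation[of "\<lambda>v. v \<in> elts (app A n)", OF this, of V]
    obtain z where z: "elts z = {v \<in> elts V. v \<in> elts (app A n)}" by blast
    show ?thesis unfolding E_def
      by (rule theI[of "\<lambda>z. elts z = {v \<in> elts V. v \<in> elts (app A n)}", OF z])
        (simp add: ext_iff z)
  qed
  have R: "?R n V y \<longleftrightarrow> elts (E n V) \<noteq> {} \<and> app f (cl (E n V)) = y"
    if n: "n \<in> elts omega" and V: "V \<in> elts B" for n V y
  proof -
    have E_iff: "elts z = {v. v \<in> elts V \<and> v \<in> elts (app A n)} \<longleftrightarrow> z = E n V" for z
      by (simp add: ext_iff E)
    have "?R n V y \<longleftrightarrow> elts (E n V) \<noteq> {} \<and> opair (cl (E n V)) y \<in> elts f"
      by (auto simp: app_eq[OF fA n, symmetric] E_iff)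
    moreover have "elts (E n V) \<subseteq> elts X" using E V B(2) open_subset by blast
    ultimately show ?thesis using point(2)[of _ "E n V" y] by blast
  qed
  have DX: "elts (app D n) \<subseteq> elts X" if "n \<in> elts omega" for n using D(2)[OF that] by blast
  have sub: "elts (app D n) \<subseteq> elts (app A n)" if n: "n \<in> elts omega" for n
  proof
    fix y assume "y \<in> elts (app D n)"
    then obtain V where V: "V \<in> elts B" "?R n V y" using D(2)[OF n] by blast
    then have y: "elts (E n V) \<noteq> {}" "app f (cl (E n V)) = y" using R[OF n V(1)] by blast+
    have "elts (E n V) \<subseteq> elts (app A n)" using E by blast
    then have "elts (cl (E n V)) \<subseteq> elts (app A n)" "elts (E n V) \<subseteq> elts X"
      using cl_minimal An[OF n] closed_in_subset by blast+
    then show "y \<in> elts (app A n)" using point(1)[of _ "E n V"] y by blast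
  qed
  have dense: "elts (app A n) \<subseteq> elts (cl (app D n))" if n: "n \<in> elts omega" for n
  proof
    fix x assume x: "x \<in> elts (app A n)"
    have AX: "elts (app A n) \<subseteq> elts X" using closed_in_subset[OF An[OF n]] .
    have "\<exists>v\<in>elts U. v \<in> elts (app D n)" if U: "U \<in> elts T" "x \<in> elts U" for U
    proof -
      obtain V' where V': "V' \<in> elts T" "x \<in> elts V'" "elts (cl V') \<subseteq> elts U"
        using regular_shrink[OF reg U] by blast
      then obtain V where V: "V \<in> elts B" "x \<in> elts V" "elts V \<subseteq> elts V'" using B(3) by blast
      have xE: "x \<in> elts (E n V)" using E x V(2) by blast
      have EX: "elts (E n V) \<subseteq> elts X" using E AX by blast
      let ?y = "app f (cl (E n V))"
      have y: "?y \<in> elts (cl (E n V))" using point(1)[OF xE EX] .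
      have "elts (E n V) \<subseteq> elts V'" using E V(3) by blast
      then have "?y \<in> elts U" using cl_mono[of "E n V" V'] y V'(3) by blast
      moreover have "?R n V ?y" unfolding R[OF n V(1)] using xE by blast
      then have "?y \<in> elts (app D n)"
        unfolding D(2)[OF n] using V(1) closed_in_subset[OF closed_in_cl] y by blast
      ultimately show ?thesis by blast
    qed
    then show "x \<in> elts (cl (app D n))" unfolding elts_cl using x AX by blast
  qed
  have "definable (\<lambda>e. \<exists>n\<in>elts omega. \<exists>z. opair n z \<in> elts D \<and> e 0 \<in> elts z)"
    by (intro definable_intro)
  from Separation[of "\<lambda>y. \<exists>n\<in>elts omega. \<exists>z. opair n z \<in> elts D \<and> y \<in> elts z", OF this, of X]
  obtain U where "elts U = {y \<in> elts X. \<exists>n\<in>elts omega. \<exists>z. opair n z \<in> elts D \<and> y \<in> elts z}"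
    by blast
  then have U: "y \<in> elts U \<longleftrightarrow> (\<exists>n\<in>elts omega. y \<in> elts (app D n))" for y
    using DX by (auto simp: app_eq[OF D(1), symmetric])
  then have U_eq: "elts U = (\<Union>n\<in>elts omega. elts (app D n))" by auto
  have "ctbl U"
  proof (rule ctblI_double_surjection[of ?R, OF dR B(1)])
    show "\<exists>n\<in>elts omega. \<exists>V\<in>elts B. ?R n V y" if y: "y \<in> elts U" for y
    proof -
      obtain n where n: "n \<in> elts omega" "y \<in> elts (app D n)" using y U by blast
      then have "?D n y" using D(2)[OF n(1)] by blast
      then show ?thesis using n(1) by blast
    qed
    show "y = y'" if "n \<in> elts omega" "V \<in> elts B" "?R n V y" "?R n V y'" for n V y y'
    proof -
      have "app f (cl (E n V)) = y" using R[OF that(1,2)] that(3) by blast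
      moreover have "app f (cl (E n V)) = y'" using R[OF that(1,2)] that(4) by blast
      ultimately show ?thesis by simp
    qed
  qed
  moreover have "ctbl (app D n)" if "n \<in> elts omega" for n
    using ctbl_subset[OF \<open>ctbl U\<close>, of "app D n"] U_eq that by blast
  ultimately show "\<exists>D. fun_on D omega
        \<and> (\<forall>n\<in>elts omega. ctbl (app D n) \<and> elts (app D n) \<subseteq> elts (app A n)
             \<and> elts (app A n) \<subseteq> closure_class X T (app D n))
        \<and> (\<exists>U. elts U = (\<Union>n\<in>elts omega. elts (app D n)) \<and> ctbl U)"
    using D(1) sub dense U_eq closure_class_eq_cl[OF DX] by (intro exI[of _ D]) auto
qed

text \<open>
  The empty set is closed, so a set with non-empty closure is non-empty.
\<close>

lemma countable_dense_selection_imp_partial_wo_selection: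
  assumes "countable_dense_selection X T" shows "partial_wo_selection X T"
  unfolding partial_wo_selection_def
proof (intro allI impI)
  fix A assume A: "seq_closed_family X T omega A"
  then obtain D where D: "fun_on D omega" "\<forall>n\<in>elts omega. ctbl (app D n)
      \<and> elts (app D n) \<subseteq> elts (app A n) \<and> elts (app A n) \<subseteq> closure_class X T (app D n)"
    using assms unfolding countable_dense_selection_def by blast
  have "elts (app D n) \<noteq> {}" if n: "n \<in> elts omega" for n
  proof
    assume e: "elts (app D n) = {}"
    then have "closure_class X T (app D n) = {}"
      using closure_class_eq_cl[of "app D n"] cl_minimal[of "app D n" "app D n"]
        closed_inI[of "app D n"] open_space by auto
    then show False using A D(2) n unfolding seq_closed_family_def by blast
  qed
  then show "\<exists>N B. elts N \<subseteq> elts omega \<and> \<not> fin N \<and> fun_on B N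
        \<and> (\<forall>n\<in>elts N. elts (app B n) \<noteq> {} \<and> well_orderable (app B n)
             \<and> elts (app B n) \<subseteq> elts (app A n))"
    using D not_fin_omega ctbl_well_orderable by blast
qed

end

theorem theorem4p21:
  fixes mem :: "'v \<Rightarrow> 'v \<Rightarrow> bool" and X T :: 'v
  assumes "zf_model mem"
    and "membership.top_space mem X T"
    and "membership.loeb mem X T"
    and "membership.regular mem X T"
  shows "(membership.first_countable mem X T \<longrightarrow>
            (membership.sequential mem X T \<longleftrightarrow> membership.wo_selection mem X T)
          \<and> (membership.sequential mem X T \<longleftrightarrow> membership.partial_wo_selection mem X T))
       \<and> (membership.second_countable mem X T \<longrightarrow>
            (membership.sequential mem X T \<longleftrightarrow> membership.wo_selection mem X T)
          \<and> (membership.sequential mem X T \<longleftrightarrow> membership.partial_wo_selection mem X T)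
          \<and> (membership.sequential mem X T \<longleftrightarrow> membership.countable_dense_selection mem X T))"
proof -
  interpret zf_space mem X T
    using assms(1,2) by (simp add: zf_space_def zf_space_axioms_def)
  show ?thesis
    using assms(3,4) sequential_imp_wo_selection wo_selection_imp_partial_wo_selection
      partial_wo_selection_imp_sequential sequential_imp_countable_dense_selection
      countable_dense_selection_imp_partial_wo_selection first_countable_if_second_countable
    by blast
qed

end
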